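(* Let $c=5.219$ and $d=30$. Then asymptotically almost surely (as $n\to\infty$) the random $d$-regular graph $\mathcal{G}_{cn,d}$ satisfies $\mathcal{G}_{cn,d}\to P_n$. Consequently $\hat{R}(P_n)<78.3n$ for all sufficiently large $n$.
   Context: $P_n$ is the path on $n$ vertices. $G\to P_n$ means every colouring of the edges of $G$ with two colours yields a monochromatic copy of $P_n$; $\hat{R}(P_n)=\min\{|E(G)|:G\to P_n\}$ is the (2-colour) size-Ramsey number. $\mathcal{G}_{N,d}$ is the uniform probability space of $d$-regular graphs on $N$ vertices (here $N=cn$, rounded to an integer). An event holds asymptotically almost surely (a.a.s.) if its probability tends to $1$ as $n\to\infty$. *)

theory Defs
  imports "HOL-Probability.Probability" "HOL-Library.Ramsey"
begin

type_synonym graph = "nat set \<times> nat set set"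

abbreviation verts :: "graph \<Rightarrow> nat set" where "verts \<equiv> fst"
abbreviation edges :: "graph \<Rightarrow> nat set set" where "edges \<equiv> snd"

text \<open>Every finite simple graph is isomorphic to one with vertices in \<^typ>\<open>nat\<close>, so nothing is
  lost by fixing this vertex type.\<close>

definition simple_graph :: "graph \<Rightarrow> bool" where
  "simple_graph G \<longleftrightarrow> finite (verts G) \<and> edges G \<subseteq> [verts G]\<^bsup>2\<^esup>"

definition vertex_degree :: "graph \<Rightarrow> nat \<Rightarrow> nat" where
  "vertex_degree G v = card {e \<in> edges G. v \<in> e}"

definition path_graph :: "nat \<Rightarrow> graph" where
  "path_graph n = ({..<n}, {{i, Suc i} |i. Suc i < n})"

text \<open>A copy of \<open>H\<close> in \<open>G\<close> is a (not necessarily induced) subgraph, given by an embedding \<open>f\<close>.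
  A colouring is a total function on sets of vertices, of which only the values on edges of \<open>G\<close>
  matter.\<close>

definition is_copy :: "(nat \<Rightarrow> nat) \<Rightarrow> graph \<Rightarrow> graph \<Rightarrow> bool" where
  "is_copy f H G \<longleftrightarrow>
     inj_on f (verts H) \<and> f ` verts H \<subseteq> verts G \<and> (\<forall>e \<in> edges H. f ` e \<in> edges G)"

definition arrows :: "graph \<Rightarrow> graph \<Rightarrow> bool" where
  "arrows G H \<longleftrightarrow>
     (\<forall>col :: nat set \<Rightarrow> bool. \<exists>f. is_copy f H G \<and> (\<exists>colour. \<forall>e \<in> edges H. col (f ` e) = colour))"

definition size_ramsey :: "graph \<Rightarrow> nat" where
  "size_ramsey H = Inf {card (edges G) |G. simple_graph G \<and> arrows G H}"

definition regular_graphs :: "nat \<Rightarrow> nat \<Rightarrow> graph set" where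
  "regular_graphs N d =
     {G. simple_graph G \<and> verts G = {..<N} \<and> (\<forall>v \<in> verts G. vertex_degree G v = d)}"

text \<open>The value is unspecified when there is no \<open>d\<close>-regular graph on \<open>N\<close> vertices, that is, unless
  \<open>d < N\<close> and \<open>N * d\<close> is even (or \<open>N = 0\<close>).\<close>

definition random_regular_graph :: "nat \<Rightarrow> nat \<Rightarrow> graph pmf" where
  "random_regular_graph N d = pmf_of_set (regular_graphs N d)"

lemma finite_regular_graphs: "finite (regular_graphs N d)"
proof (rule finite_subset)
  show "regular_graphs N d \<subseteq> {{..<N}} \<times> Pow ([{..<N}]\<^bsup>2\<^esup>)"
    by (auto simp: regular_graphs_def simple_graph_def)
  show "finite ({{..<N}} \<times> Pow ([{..<N}]\<^bsup>2\<^esup>))"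
    by (simp add: finite_imp_finite_nsets)
qed

text \<open>The infimum over \<^typ>\<open>nat\<close> of the empty set is \<open>0\<close>; by Ramsey's theorem this case does not
  arise, and the minimum defining the size-Ramsey number of a path is attained.\<close>

lemma ex_arrows_path_graph: "\<exists>G. simple_graph G \<and> arrows G (path_graph n)"
proof -
  obtain r where r: "\<And>V E. finite (V :: nat set) \<Longrightarrow> r \<le> card V \<Longrightarrow>
      \<exists>R \<subseteq> V. (card R = n \<and> clique R E) \<or> (card R = n \<and> indep R E)"
    using ramsey2[of n n] by metis
  define G :: graph where "G = ({..<r}, [{..<r}]\<^bsup>2\<^esup>)"
  have "arrows G (path_graph n)"
    unfolding arrows_def
  proof
    fix col :: "nat set \<Rightarrow> bool"
    obtain R where R: "R \<subseteq> {..<r}" "card R = n" "clique R {e. col e} \<or> indep R {e. col e}"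
      using r[of "{..<r}" "{e. col e}"] by auto
    have "finite R" using R(1) finite_subset by blast
    then obtain f where f: "bij_betw f {..<n} R"
      using R(2) ex_bij_betw_nat_finite[of R] by (auto simp: atLeast0LessThan)
    have mem: "f i \<in> R" if "i < n" for i
      using f that by (auto simp: bij_betw_def)
    have neq: "f i \<noteq> f (Suc i)" if "Suc i < n" for i
      using f that inj_onD[of f "{..<n}" i "Suc i"] by (auto simp: bij_betw_def)
    have "is_copy f (path_graph n) G"
      using f R(1) mem neq
      by (fastforce simp: is_copy_def path_graph_def G_def bij_betw_def)
    moreover have "\<exists>colour. \<forall>e \<in> edges (path_graph n). col (f ` e) = colour"
      using R(3)
    proof
      assume "clique R {e. col e}"
      then have "\<forall>e \<in> edges (path_graph n). col (f ` e) = True"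
        using mem neq by (auto simp: path_graph_def clique_def)
      then show ?thesis by blast
    next
      assume "indep R {e. col e}"
      then have "\<forall>e \<in> edges (path_graph n). col (f ` e) = False"
        using mem neq by (auto simp: path_graph_def indep_def)
      then show ?thesis by blast
    qed
    ultimately show "\<exists>f. is_copy f (path_graph n) G \<and>
        (\<exists>colour. \<forall>e \<in> edges (path_graph n). col (f ` e) = colour)" by blast
  qed
  moreover have "simple_graph G" by (simp add: simple_graph_def G_def)
  ultimately show ?thesis by blast
qed

lemma size_ramsey_path_graph_attained:
  "\<exists>G. simple_graph G \<and> arrows G (path_graph n) \<and> card (edges G) = size_ramsey (path_graph n)"
proof -
  let ?S = "{card (edges G) |G. simple_graph G \<and> arrows G (path_graph n)}"
  have "Inf ?S \<in> ?S" using ex_arrows_path_graph[of n] by (intro Inf_nat_def1) auto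
  then have "size_ramsey (path_graph n) \<in> ?S" by (simp only: size_ramsey_def)
  then show ?thesis by (auto simp del: split_paired_Ex)
qed

end

theory Submission
  imports Defs "HOL-Combinatorics.Transposition"
begin

text \<open>If a graph on \<open>N\<close> vertices has a colouring without monochromatic \<open>P\<^sub>n\<close>, depth-first search in the
  first colour leaves two equal sets of about \<open>(N - n) / 2\<close> vertices with only edges of the second
  colour between them. Depth-first search in the bipartite graph between them then leaves two disjoint
  sets of at least \<open>(N - 2 n) / 4\<close> vertices with no edge between them.

  A random regular graph has no such pair of sets by the first moment method in the configuration
  model, with two simplifications. The number of configurations avoiding a fixed pair of sets is
  bounded by a generating function evaluated at one point. Moreover, the first moment is exponentially
  small, so that it suffices to know that a polynomial fraction of all configurations is simple; this
  holds because at least half of the configurations have a bounded number of loops and multiple edges,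
  and one transposition of two points reduces this number.\<close>

section \<open>Pairs of sets without edges between them\<close>

text \<open>By symmetry of the positions in a configuration, the positions taken by the letters of
  \<open>S\<close> and \<open>T\<close> form a uniformly random pair of disjoint sets of size
  \<open>d * k\<close>. With H the entropy of (k/N, k/N, 1 - 2k/N), the expected number of separated
  pairs is therefore, up to polynomial factors, at most exp (N H), the number of pairs
  \<open>(S, T)\<close>, times (1 + 4 x + 2 x^2)^(d N / 2) / x^(2 d k), a bound for the patterns
  without an edge between the sets, divided by exp (d N H), the number of all patterns. Here k / N
  tends to (c - 2) / (4 c). For d = 30 and c = 5.219 the resulting rate per vertex is negative only
  by the order of 10^-4, so the constants in the exponent need precise estimates, while crude
  Stirling bounds suffice. The graph has 15 N edges, about 78.285 n, which leaves room for rounding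
  below 78.3 n.\<close>

text \<open>Depth-first search after \<open>j\<close> steps: \<open>P\<close> is the stack with its
  top at the head, \<open>U\<close> the unvisited and \<open>B\<close> the finished vertices. Each
  step either pushes a vertex of \<open>U\<close> or moves the top of the stack to \<open>B\<close>,
  so \<open>card U - card B\<close> falls by exactly one.\<close>

lemma path_separation_step:
  fixes R :: "'a \<Rightarrow> 'a \<Rightarrow> bool"
  assumes "finite V" "symp R" "j \<le> card V"
  shows "\<exists>P U B. distinct P \<and> successively R P \<and> set P \<union> U \<union> B = V \<and> set P \<inter> U = {} \<and>
           set P \<inter> B = {} \<and> U \<inter> B = {} \<and> card U + j = card B + card V \<and>
           (\<forall>u\<in>U. \<forall>b\<in>B. \<not> R u b)"
  using \<open>j \<le> card V\<close>
proof (induction j)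
  case 0
  show ?case by (rule exI[of _ "[]"], rule exI[of _ V], rule exI[of _ "{}"]) auto
next
  case (Suc j)
  then obtain P U B where I: "distinct P" "successively R P" "set P \<union> U \<union> B = V" "set P \<inter> U = {}"
      "set P \<inter> B = {}" "U \<inter> B = {}" "card U + j = card B + card V" "\<forall>u\<in>U. \<forall>b\<in>B. \<not> R u b"
    by auto
  have fin: "finite U" "finite B" using I(3) assms(1) by auto
  have "card U > 0" using I(7) Suc.prems by linarith
  then obtain u0 where u0: "u0 \<in> U" by fastforce
  show ?case
  proof (cases "P \<noteq> [] \<and> (\<forall>u\<in>U. \<not> R u (hd P))")
    \<comment> \<open>No unvisited vertex is adjacent to the top of the stack, so finishing it
      creates no edge between \<open>U\<close> and \<open>B\<close>.\<close>
    case True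
    then obtain p P' where P: "P = p # P'" by (cases P) auto
    have "card U + Suc j = card (insert p B) + card V" using I P fin by auto
    moreover have "successively R P'" using I(2) P by (cases P') auto
    ultimately show ?thesis using I P True
      by (intro exI[of _ P'] exI[of _ U] exI[of _ "insert p B"]) auto
  next
    case False
    \<comment> \<open>An empty stack is restarted with an arbitrary unvisited vertex.\<close>
    then obtain u where u: "u \<in> U" "P = [] \<or> R u (hd P)" using u0 by auto
    have "card (U - {u}) + Suc j = card B + card V" using I u fin \<open>card U > 0\<close> by simp
    moreover have "successively R (u # P)" using I(2) u by (cases P) auto
    moreover have "set (u # P) \<union> (U - {u}) \<union> B = V" "distinct (u # P)"
      "set (u # P) \<inter> (U - {u}) = {}" "set (u # P) \<inter> B = {}" "(U - {u}) \<inter> B = {}"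
      "\<forall>u\<in>U - {u}. \<forall>b\<in>B. \<not> R u b"
      using I u by auto
    ultimately show ?thesis by blast
  qed
qed

text \<open>The difference \<open>card U - card B\<close> starts at \<open>card V\<close> and falls
  by one per step, so it vanishes after \<open>card V\<close> steps.\<close>

lemma path_separation:
  fixes R :: "'a \<Rightarrow> 'a \<Rightarrow> bool"
  assumes "finite V" "symp R"
  obtains P U B where "distinct P" "successively R P" "set P \<union> U \<union> B = V" "set P \<inter> U = {}"
    "set P \<inter> B = {}" "U \<inter> B = {}" "card U = card B" "card V = length P + 2 * card U"
    "\<And>u b. u \<in> U \<Longrightarrow> b \<in> B \<Longrightarrow> \<not> R u b"
proof -
  obtain P U B where I: "distinct P" "successively R P" "set P \<union> U \<union> B = V" "set P \<inter> U = {}"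
      "set P \<inter> B = {}" "U \<inter> B = {}" "card U + card V = card B + card V" "\<forall>u\<in>U. \<forall>b\<in>B. \<not> R u b"
    using path_separation_step[OF assms order.refl] by blast
  have fin: "finite U" "finite B" using I(3) assms(1) by auto
  have "card V = card (set P \<union> U) + card B"
    using I(3-6) fin by (metis Int_Un_distrib2 List.finite_set card_Un_disjoint finite_UnI sup_bot.left_neutral)
  also have "card (set P \<union> U) = length P + card U"
    using I(1,4) fin by (simp add: card_Un_disjoint distinct_card)
  finally have "card V = length P + 2 * card U" using I(7) by simp
  with I that show ?thesis by auto
qed

section \<open>From coloured graphs to separated pairs of sets\<close>

lemma arrows_path_graphI:
  assumes "\<And>col :: nat set \<Rightarrow> bool. \<exists>P colour. n \<le> length P \<and> distinct P \<and> set P \<subseteq> verts G \<and>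
             successively (\<lambda>u v. {u, v} \<in> edges G \<and> col {u, v} = colour) P"
  shows "arrows G (path_graph n)"
  unfolding arrows_def
proof
  fix col :: "nat set \<Rightarrow> bool"
  obtain P colour where P: "n \<le> length P" "distinct P" "set P \<subseteq> verts G"
    and succ: "successively (\<lambda>u v. {u, v} \<in> edges G \<and> col {u, v} = colour) P"
    using assms by blast
  have step: "{P ! i, P ! Suc i} \<in> edges G \<and> col {P ! i, P ! Suc i} = colour" if "Suc i < n" for i
    using successively_nth[OF succ, of i] that P(1) by simp
  have "is_copy ((!) P) (path_graph n) G"
    using P step by (auto simp: is_copy_def path_graph_def inj_on_def nth_eq_iff_index_eq)
  moreover have "\<forall>e \<in> edges (path_graph n). col ((!) P ` e) = colour"
    using step by (auto simp: path_graph_def)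
  ultimately show "\<exists>f. is_copy f (path_graph n) G \<and> (\<exists>colour. \<forall>e \<in> edges (path_graph n). col (f ` e) = colour)"
    by blast
qed

text \<open>Both claims share one induction, since removing the head exchanges the roles of
  \<open>A\<close> and \<open>B\<close>.\<close>

lemma card_alternating_path:
  assumes "successively (\<lambda>u v. u \<in> A \<and> v \<in> B \<or> u \<in> B \<and> v \<in> A) P" "distinct P" "set P \<subseteq> A \<union> B"
    "A \<inter> B = {}"
  shows "P \<noteq> [] \<Longrightarrow> hd P \<in> A \<Longrightarrow> card (set P \<inter> A) = card (set P \<inter> B) \<or> card (set P \<inter> A) = Suc (card (set P \<inter> B))"
    and "P \<noteq> [] \<Longrightarrow> hd P \<in> B \<Longrightarrow> card (set P \<inter> A) = card (set P \<inter> B) \<or> Suc (card (set P \<inter> A)) = card (set P \<inter> B)"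
proof -
  have "(P \<noteq> [] \<longrightarrow> hd P \<in> A \<longrightarrow> card (set P \<inter> A) = card (set P \<inter> B) \<or> card (set P \<inter> A) = Suc (card (set P \<inter> B))) \<and>
    (P \<noteq> [] \<longrightarrow> hd P \<in> B \<longrightarrow> card (set P \<inter> A) = card (set P \<inter> B) \<or> Suc (card (set P \<inter> A)) = card (set P \<inter> B))"
    using assms
  proof (induction P)
    case (Cons p P)
    show ?case
    proof (cases P)
      case Nil
      then show ?thesis using Cons.prems by auto
    next
      case C: (Cons q Q)
      have "p \<notin> set P" using Cons.prems by auto
      then show ?thesis using Cons C by (auto simp: Int_insert_left)
    qed
  qed simp
  then show "P \<noteq> [] \<Longrightarrow> hd P \<in> A \<Longrightarrow> card (set P \<inter> A) = card (set P \<inter> B) \<or> card (set P \<inter> A) = Suc (card (set P \<inter> B))"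
    and "P \<noteq> [] \<Longrightarrow> hd P \<in> B \<Longrightarrow> card (set P \<inter> A) = card (set P \<inter> B) \<or> Suc (card (set P \<inter> A)) = card (set P \<inter> B)"
    by auto
qed

text \<open>Polymorphic because the same count serves sets of vertices and sets of
  positions.\<close>

definition disjoint_pairs :: "'a set \<Rightarrow> nat \<Rightarrow> ('a set \<times> 'a set) set" where
  "disjoint_pairs X k = {(S, T). S \<subseteq> X \<and> T \<subseteq> X \<and> S \<inter> T = {} \<and> card S = k \<and> card T = k}"

lemma disjoint_pair_of_large:
  assumes "S \<subseteq> X" "T \<subseteq> X" "S \<inter> T = {}" "k \<le> card S" "k \<le> card T"
  obtains S' T' where "(S', T') \<in> disjoint_pairs X k" "S' \<subseteq> S" "T' \<subseteq> T"
proof -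
  obtain S' where "S' \<subseteq> S" "card S' = k" using assms(4) by (meson obtain_subset_with_card_n)
  moreover obtain T' where "T' \<subseteq> T" "card T' = k" using assms(5) by (meson obtain_subset_with_card_n)
  ultimately show ?thesis using that[of S' T'] assms(1-3) unfolding disjoint_pairs_def by blast
qed

definition separated :: "graph \<Rightarrow> nat set \<Rightarrow> nat set \<Rightarrow> bool" where
  "separated G S T \<longleftrightarrow> (\<forall>s\<in>S. \<forall>t\<in>T. {s, t} \<notin> edges G)"

text \<open>Two monochromatic paths \<open>P\<close> and \<open>Q\<close> use fewer than
  \<open>2 * n\<close> of the N vertices, so \<open>U\<close> and \<open>W\<close> have more than (N
  - 2 n) / 2 elements each. As \<open>Q\<close> meets \<open>A\<close> and \<open>B\<close> equally
  often, \<open>U \<inter> A\<close> is as large as \<open>W \<inter> B\<close>, and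
  \<open>U \<inter> B\<close> as large as \<open>W \<inter> A\<close>; the larger of these two
  separated pairs is big enough.\<close>

lemma arrows_path_graph_if_no_separated:
  assumes "finite (verts G)"
    and no_sep: "\<And>S T. (S, T) \<in> disjoint_pairs (verts G) ((card (verts G) - 2 * n) div 4) \<Longrightarrow> \<not> separated G S T"
  shows "arrows G (path_graph n)"
proof (rule arrows_path_graphI, rule ccontr)
  fix col :: "nat set \<Rightarrow> bool"
  let ?V = "verts G" and ?N = "card (verts G)"
  let ?k = "(?N - 2 * n) div 4"
  assume "\<nexists>P colour. n \<le> length P \<and> distinct P \<and> set P \<subseteq> verts G \<and>
             successively (\<lambda>u v. {u, v} \<in> edges G \<and> col {u, v} = colour) P"
  then have short: "length P < n" if "distinct P" "set P \<subseteq> verts G"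
      "successively (\<lambda>u v. {u, v} \<in> edges G \<and> col {u, v} = colour) P" for P colour
    using that not_less by blast
  have sym: "symp (\<lambda>u v. {u, v} \<in> edges G \<and> col {u, v} = True)"
    by (auto simp: symp_def insert_commute)
  obtain P A B where P: "distinct P" "successively (\<lambda>u v. {u, v} \<in> edges G \<and> col {u, v} = True) P"
    "set P \<union> A \<union> B = ?V" "A \<inter> B = {}" "card A = card B" "?N = length P + 2 * card A"
    and AB: "\<And>u b. u \<in> A \<Longrightarrow> b \<in> B \<Longrightarrow> \<not> ({u, b} \<in> edges G \<and> col {u, b} = True)"
    by (rule path_separation[OF assms(1) sym]) blast
  have lP: "length P < n" using short[OF P(1) _ P(2)] P(3) by blast
  have finAB: "finite A" "finite B" using P(3) assms(1) by (metis finite_Un)+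
  \<comment> \<open>All edges between \<open>A\<close> and \<open>B\<close>, whatever their colour.
    None has colour \<open>True\<close>, so an \<open>R\<close>-path is monochromatic, and sets
    without \<open>R\<close>-edges are separated in \<open>G\<close> itself.\<close>
  define R where "R = (\<lambda>u v. {u, v} \<in> edges G \<and> (u \<in> A \<and> v \<in> B \<or> u \<in> B \<and> v \<in> A))"
  have "symp R" by (auto simp: symp_def R_def insert_commute)
  moreover have "finite (A \<union> B)" using finAB by simp
  ultimately obtain Q U W where Q: "distinct Q" "successively R Q" "set Q \<union> U \<union> W = A \<union> B" "set Q \<inter> U = {}"
    "set Q \<inter> W = {}" "U \<inter> W = {}" "card U = card W" "card (A \<union> B) = length Q + 2 * card U"
    "\<And>u b. u \<in> U \<Longrightarrow> b \<in> W \<Longrightarrow> \<not> R u b"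
    using path_separation[of "A \<union> B" R] by blast
  have cAB: "card (A \<union> B) = 2 * card A" using finAB P(4,5) by (simp add: card_Un_disjoint)
  have AB': "\<not> ({b, u} \<in> edges G \<and> col {b, u} = True)" if "u \<in> A" "b \<in> B" for u b
    using AB[OF that] by (simp add: insert_commute)
  have "successively (\<lambda>u v. {u, v} \<in> edges G \<and> col {u, v} = False) Q"
    by (rule successively_mono[OF Q(2)]) (use AB AB' in \<open>auto simp: R_def\<close>)
  then have lQ: "length Q < n" using short[OF Q(1)] Q(3) P(3) by blast
  have alt: "successively (\<lambda>u v. u \<in> A \<and> v \<in> B \<or> u \<in> B \<and> v \<in> A) Q"
    by (rule successively_mono[OF Q(2)]) (auto simp: R_def)
  have QAB: "set Q \<subseteq> A \<union> B" using Q(3) by blast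
  have balance: "card (set Q \<inter> A) \<le> Suc (card (set Q \<inter> B))" "card (set Q \<inter> B) \<le> Suc (card (set Q \<inter> A))"
    using card_alternating_path[OF alt Q(1) QAB P(4)] QAB
    by (cases Q; force)+
  have split: "card (X \<inter> A) + card (X \<inter> B) = card X" if "X \<subseteq> A \<union> B" for X
  proof -
    have "X = (X \<inter> A) \<union> (X \<inter> B)" using that by blast
    then show ?thesis using P(4) finAB by (metis card_Un_disjoint finite_Int inf_assoc inf_bot_right inf_left_commute)
  qed
  have parts: "card (set Q \<inter> X) + card (U \<inter> X) + card (W \<inter> X) = card X"
    if "X \<subseteq> A \<union> B" "finite X" for X
  proof -
    have "X = (set Q \<inter> X) \<union> (U \<inter> X) \<union> (W \<inter> X)" using that Q(3) by blast
    then have "card X = card ((set Q \<inter> X) \<union> (U \<inter> X) \<union> (W \<inter> X))" by simp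
    also have "\<dots> = card (set Q \<inter> X) + card (U \<inter> X) + card (W \<inter> X)"
      using Q(4-6) that(2) by (subst card_Un_disjoint; (subst card_Un_disjoint)?) (auto)
    finally show ?thesis by simp
  qed
  have c: "card (set Q \<inter> A) + card (set Q \<inter> B) = length Q"
    "card (U \<inter> A) + card (U \<inter> B) = card U" "card (W \<inter> A) + card (W \<inter> B) = card W"
    "card (set Q \<inter> A) + card (U \<inter> A) + card (W \<inter> A) = card A"
    "card (set Q \<inter> B) + card (U \<inter> B) + card (W \<inter> B) = card B"
    using split[OF QAB] split[of U] split[of W] Q(1,3) parts[of A] parts[of B] finAB
    by (auto simp: distinct_card)
  have sep: "separated G (U \<inter> A) (W \<inter> B)" "separated G (U \<inter> B) (W \<inter> A)"
    using Q(9) by (auto simp: separated_def R_def)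
  have contra: False if sepST: "separated G S T" "S \<subseteq> ?V" "T \<subseteq> ?V" "S \<inter> T = {}" "?k \<le> card S" "?k \<le> card T" for S T
  proof -
    obtain S' T' where "(S', T') \<in> disjoint_pairs ?V ?k" "S' \<subseteq> S" "T' \<subseteq> T"
      using disjoint_pair_of_large[OF sepST(2-6)] by blast
    then show False using no_sep[of S' T'] sepST(1) by (auto simp: separated_def)
  qed
  \<comment> \<open>Since \<open>card (A \<union> B) = length Q + 2 * card U\<close> is even,
    \<open>length Q\<close> is even, which sharpens the near balance of \<open>Q\<close> to
    equality.\<close>
  have eq: "card (U \<inter> A) = card (W \<inter> B)" "card (U \<inter> B) = card (W \<inter> A)"
    using c Q(7,8) P(5) cAB balance by presburger+
  have "?k \<le> card (U \<inter> A) \<or> ?k \<le> card (U \<inter> B)"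
    using c eq Q(8) P(6) cAB lP lQ by linarith
  then show False
    using contra[OF sep(1)] contra[OF sep(2)] eq P(3) Q(3,6) by (auto simp: Int_ac)
qed

section \<open>The configuration model\<close>

lemma finite_disjoint_pairs: "finite X \<Longrightarrow> finite (disjoint_pairs X k)"
  by (rule finite_subset[of _ "Pow X \<times> Pow X"]) (auto simp: disjoint_pairs_def)

lemma card_disjoint_pairs:
  assumes "finite X"
  shows "card (disjoint_pairs X k) = (card X choose k) * ((card X - k) choose k)"
proof -
  have "disjoint_pairs X k = Sigma {S. S \<subseteq> X \<and> card S = k} (\<lambda>S. {T. T \<subseteq> X - S \<and> card T = k})"
    by (auto simp: disjoint_pairs_def)
  moreover have "card {T. T \<subseteq> X - S \<and> card T = k} = (card X - k) choose k" if "S \<subseteq> X" "card S = k" for S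
    using assms that by (simp add: n_subsets card_Diff_subset finite_subset)
  ultimately show ?thesis
    using assms by (simp add: n_subsets)
qed

text \<open>Bijections from \<open>A'\<close> to \<open>A\<close>, from \<open>B'\<close> to
  \<open>B\<close> and between the complements are glued. The direction fits composing words with
  \<open>f\<close> on the right.\<close>

lemma disjoint_pairs_transitive:
  assumes "finite X" "(A, B) \<in> disjoint_pairs X k" "(A', B') \<in> disjoint_pairs X k"
  obtains f where "bij_betw f X X" "\<And>x. x \<in> X \<Longrightarrow> f x \<in> A \<longleftrightarrow> x \<in> A'" "\<And>x. x \<in> X \<Longrightarrow> f x \<in> B \<longleftrightarrow> x \<in> B'"
proof -
  have sub: "A \<subseteq> X" "B \<subseteq> X" "A' \<subseteq> X" "B' \<subseteq> X" "A \<inter> B = {}" "A' \<inter> B' = {}"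
    "card A = k" "card B = k" "card A' = k" "card B' = k"
    using assms by (auto simp: disjoint_pairs_def)
  have fin: "finite A" "finite B" "finite A'" "finite B'" using sub assms(1) finite_subset by auto
  have "card (X - (C \<union> D)) = card X - (k + k)"
    if "C \<subseteq> X" "D \<subseteq> X" "C \<inter> D = {}" "finite C" "finite D" "card C = k" "card D = k" for C D
    using card_Diff_subset[of "C \<union> D" X] card_Un_disjoint[of C D] that by auto
  from this[OF sub(1,2,5) fin(1,2) sub(7,8)] this[OF sub(3,4,6) fin(3,4) sub(9,10)]
  have "card (X - (A' \<union> B')) = card (X - (A \<union> B))" by simp
  then obtain f3 where f3: "bij_betw f3 (X - (A' \<union> B')) (X - (A \<union> B))"
    using finite_same_card_bij[of "X - (A' \<union> B')" "X - (A \<union> B)"] assms(1) by blast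
  obtain f1 where f1: "bij_betw f1 A' A" using finite_same_card_bij[OF fin(3,1)] sub(7,9) by auto
  obtain f2 where f2: "bij_betw f2 B' B" using finite_same_card_bij[OF fin(4,2)] sub(8,10) by auto
  define f where "f x = (if x \<in> A' then f1 x else if x \<in> B' then f2 x else f3 x)" for x
  have 1: "bij_betw f A' A" using f1 by (subst bij_betw_cong[of _ _ f1]) (auto simp: f_def)
  have 2: "bij_betw f B' B" using f2 sub by (subst bij_betw_cong[of _ _ f2]) (auto simp: f_def)
  have 3: "bij_betw f (X - (A' \<union> B')) (X - (A \<union> B))"
    using f3 by (subst bij_betw_cong[of _ _ f3]) (auto simp: f_def)
  have 4: "bij_betw f (A' \<union> B' \<union> (X - (A' \<union> B'))) (A \<union> B \<union> (X - (A \<union> B)))"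
    using sub by (intro bij_betw_combine 1 2 3) auto
  moreover have "A' \<union> B' \<union> (X - (A' \<union> B')) = X" "A \<union> B \<union> (X - (A \<union> B)) = X" using sub by auto
  ultimately have "bij_betw f X X" by simp
  moreover have "f x \<in> A \<longleftrightarrow> x \<in> A'" "f x \<in> B \<longleftrightarrow> x \<in> B'" if "x \<in> X" for x
    using 1 2 3 that sub(5) unfolding bij_betw_def by blast+
  ultimately show ?thesis using that by blast
qed

section \<open>Words and the positions of their letters\<close>

definition positions :: "nat \<Rightarrow> (nat \<times> bool) set" where
  "positions M = {..<M} \<times> UNIV"

text \<open>A word is a configuration: its \<open>i\<close>-th pair of letters is the \<open>i\<close>-th edge. The \<open>d\<close> points of a
  vertex are not distinguished, so each word stands for \<open>(d!)\<^sup>N\<close> labelled configurations.\<close>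

definition words :: "nat \<Rightarrow> nat \<Rightarrow> nat \<Rightarrow> (nat \<times> bool \<Rightarrow> nat) set" where
  "words N M d = {w \<in> positions M \<rightarrow>\<^sub>E {..<N}. \<forall>v<N. card {p \<in> positions M. w p = v} = d}"

lemma finite_positions [simp]: "finite (positions M)"
  by (simp add: positions_def)

lemma card_positions [simp]: "card (positions M) = 2 * M"
  by (simp add: positions_def card_cartesian_product)

lemma finite_words [simp]: "finite (words N M d)"
  by (rule finite_subset[of _ "positions M \<rightarrow>\<^sub>E {..<N}"]) (auto simp: words_def intro!: finite_PiE)

lemma words_less: "w \<in> words N M d \<Longrightarrow> p \<in> positions M \<Longrightarrow> w p < N"
  by (auto simp: words_def)

lemma card_positions_letters:
  assumes "w \<in> words N M d" "S \<subseteq> {..<N}"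
  shows "card {p \<in> positions M. w p \<in> S} = d * card S"
proof -
  have fin: "finite S" using assms(2) finite_subset by blast
  have "{p \<in> positions M. w p \<in> S} = (\<Union>v\<in>S. {p \<in> positions M. w p = v})" by auto
  also have "card \<dots> = (\<Sum>v\<in>S. card {p \<in> positions M. w p = v})"
    using fin by (intro card_UN_disjoint) auto
  also have "\<dots> = (\<Sum>v\<in>S. d)"
    using assms by (intro sum.cong) (auto simp: words_def)
  finally show ?thesis by simp
qed

lemma words_permute:
  assumes "w \<in> words N M d" "bij_betw f (positions M) (positions M)"
  shows "restrict (w \<circ> f) (positions M) \<in> words N M d"
proof -
  have mem: "f p \<in> positions M" if "p \<in> positions M" for p
    using assms(2) that by (auto simp: bij_betw_def)
  have "card {p \<in> positions M. restrict (w \<circ> f) (positions M) p = v} = d" if "v < N" for v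
  proof -
    have "inj_on f {p \<in> positions M. w (f p) = v}"
      using assms(2) by (auto simp: bij_betw_def inj_on_def)
    moreover have "f ` {p \<in> positions M. w (f p) = v} = {p \<in> positions M. w p = v}"
    proof (intro subset_antisym subsetI)
      fix q assume q: "q \<in> {p \<in> positions M. w p = v}"
      then have "q \<in> f ` positions M" using assms(2) by (simp add: bij_betw_def)
      then show "q \<in> f ` {p \<in> positions M. w (f p) = v}" using q by blast
    qed (use mem in blast)
    ultimately have "bij_betw f {p \<in> positions M. w (f p) = v} {p \<in> positions M. w p = v}"
      by (simp add: bij_betw_def)
    moreover have "{p \<in> positions M. restrict (w \<circ> f) (positions M) p = v} = {p \<in> positions M. w (f p) = v}"
      by auto
    ultimately show ?thesis using assms(1) that bij_betw_same_card unfolding words_def by fastforce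
  qed
  moreover have "restrict (w \<circ> f) (positions M) \<in> positions M \<rightarrow>\<^sub>E {..<N}"
    using mem words_less[OF assms(1)] by auto
  ultimately show ?thesis by (simp add: words_def)
qed

definition pattern :: "nat \<Rightarrow> nat set \<Rightarrow> nat set \<Rightarrow> (nat \<times> bool \<Rightarrow> nat) \<Rightarrow> (nat \<times> bool) set \<times> (nat \<times> bool) set" where
  "pattern M S T w = ({p \<in> positions M. w p \<in> S}, {p \<in> positions M. w p \<in> T})"

text \<open>Permuting positions maps one fibre injectively into the other. With the roles exchanged
  this gives equality: the pattern of a uniformly random word is uniform.\<close>

lemma card_pattern_fibre_le:
  assumes "(A, B) \<in> disjoint_pairs (positions M) s" "(A', B') \<in> disjoint_pairs (positions M) s"
  shows "card {w \<in> words N M d. pattern M S T w = (A, B)} \<le> card {w \<in> words N M d. pattern M S T w = (A', B')}"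
proof -
  obtain f where f: "bij_betw f (positions M) (positions M)"
    "\<And>x. x \<in> positions M \<Longrightarrow> f x \<in> A \<longleftrightarrow> x \<in> A'" "\<And>x. x \<in> positions M \<Longrightarrow> f x \<in> B \<longleftrightarrow> x \<in> B'"
    using disjoint_pairs_transitive[OF finite_positions assms] by blast
  have sub: "A' \<subseteq> positions M" "B' \<subseteq> positions M" using assms by (auto simp: disjoint_pairs_def)
  let ?g = "\<lambda>w. restrict (w \<circ> f) (positions M)"
  show ?thesis
  proof (rule card_inj_on_le[of ?g])
    show "inj_on ?g {w \<in> words N M d. pattern M S T w = (A, B)}"
    proof (rule inj_onI)
      fix u w assume uw: "u \<in> {w \<in> words N M d. pattern M S T w = (A, B)}"
        "w \<in> {w \<in> words N M d. pattern M S T w = (A, B)}" "?g u = ?g w"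
      have "u q = w q" if "q \<in> positions M" for q
      proof -
        have "q \<in> f ` positions M" using f(1) that by (simp add: bij_betw_def)
        then obtain p where "p \<in> positions M" "q = f p" by blast
        then show ?thesis using fun_cong[OF uw(3), of p] by simp
      qed
      then show "u = w" using uw by (intro PiE_ext[of u "positions M" "\<lambda>_. {..<N}"]) (auto simp: words_def)
    qed
    show "?g ` {w \<in> words N M d. pattern M S T w = (A, B)} \<subseteq> {w \<in> words N M d. pattern M S T w = (A', B')}"
    proof (intro image_subsetI CollectI conjI)
      fix w assume w: "w \<in> {w \<in> words N M d. pattern M S T w = (A, B)}"
      then show "?g w \<in> words N M d" using f(1) words_permute by blast
      have "f p \<in> positions M" if "p \<in> positions M" for p
        using f(1) that by (auto simp: bij_betw_def)
      then show "pattern M S T (?g w) = (A', B')" using w f(2,3) sub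
        unfolding pattern_def by auto
    qed
  qed simp
qed

section \<open>Proportion of words without an edge between two sets\<close>

definition avoids :: "nat \<Rightarrow> (nat \<times> bool) set \<Rightarrow> (nat \<times> bool) set \<Rightarrow> bool" where
  "avoids M A B \<longleftrightarrow> (\<forall>i<M. \<forall>b. (i, b) \<in> A \<longrightarrow> (i, \<not> b) \<notin> B)"

lemma card_eq_sum_fibres:
  assumes "finite A" "finite B" "f ` A \<subseteq> B"
  shows "card A = (\<Sum>y\<in>B. card {x \<in> A. f x = y})"
  using sum.group[OF assms, of "\<lambda>_. 1::nat"] by simp

text \<open>All fibres of \<open>pattern\<close> have the same size \<open>F\<close>, so the
  proportion of avoiding words equals that of avoiding patterns. Cross-multiplication keeps this
  within the natural numbers.\<close>

lemma card_words_avoids: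
  assumes "(S, T) \<in> disjoint_pairs {..<N} k"
  shows "card {w \<in> words N M d. case_prod (avoids M) (pattern M S T w)} * card (disjoint_pairs (positions M) (d * k)) =
    card {x \<in> disjoint_pairs (positions M) (d * k). case_prod (avoids M) x} * card (words N M d)"
proof -
  let ?D = "disjoint_pairs (positions M) (d * k)"
  have ST: "S \<subseteq> {..<N}" "T \<subseteq> {..<N}" "S \<inter> T = {}" "card S = k" "card T = k"
    using assms by (auto simp: disjoint_pairs_def)
  have pat: "pattern M S T ` words N M d \<subseteq> ?D"
    using ST card_positions_letters by (auto simp: disjoint_pairs_def pattern_def)
  obtain F where F: "\<And>x. x \<in> ?D \<Longrightarrow> card {w \<in> words N M d. pattern M S T w = x} = F"
  proof (cases "?D = {}")
    case False
    then obtain A B where AB: "(A, B) \<in> ?D" by fast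
    have "card {w \<in> words N M d. pattern M S T w = x} = card {w \<in> words N M d. pattern M S T w = (A, B)}"
      if "x \<in> ?D" for x
      using that card_pattern_fibre_le[OF _ AB] card_pattern_fibre_le[OF AB]
      by (cases x) (simp add: antisym)
    with that show ?thesis by blast
  qed simp
  have fin: "finite ?D" by (simp add: finite_disjoint_pairs)
  have "card (words N M d) = (\<Sum>x\<in>?D. card {w \<in> words N M d. pattern M S T w = x})"
    by (rule card_eq_sum_fibres) (use pat fin in auto)
  then have 1: "card (words N M d) = card ?D * F" using F by simp
  let ?D' = "{x \<in> ?D. case_prod (avoids M) x}"
  let ?W' = "{w \<in> words N M d. case_prod (avoids M) (pattern M S T w)}"
  have "card ?W' = (\<Sum>x\<in>?D'. card {w \<in> ?W'. pattern M S T w = x})"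
    by (rule card_eq_sum_fibres) (use pat fin in auto)
  also have "\<dots> = (\<Sum>x\<in>?D'. F)"
  proof (rule sum.cong[OF refl])
    fix x assume x: "x \<in> ?D'"
    then have "{w \<in> ?W'. pattern M S T w = x} = {w \<in> words N M d. pattern M S T w = x}" by auto
    then show "card {w \<in> ?W'. pattern M S T w = x} = F" using F x by simp
  qed
  finally show ?thesis using 1 by simp
qed

lemma bij_betw_pairs:
  "bij_betw (\<lambda>w. \<lambda>i\<in>{..<M}. (w (i, False), w (i, True))) (positions M \<rightarrow>\<^sub>E V) ({..<M} \<rightarrow>\<^sub>E V \<times> V)"
proof (rule bij_betw_byWitness[where f' = "\<lambda>g. \<lambda>p\<in>positions M. (if snd p then snd else fst) (g (fst p))"])
  show "\<forall>w\<in>positions M \<rightarrow>\<^sub>E V. (\<lambda>p\<in>positions M. (if snd p then snd else fst) ((\<lambda>i\<in>{..<M}. (w (i, False), w (i, True))) (fst p))) = w"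
    by (auto simp: positions_def fun_eq_iff PiE_def extensional_def)
  show "\<forall>g\<in>{..<M} \<rightarrow>\<^sub>E V \<times> V. (\<lambda>i\<in>{..<M}. ((\<lambda>p\<in>positions M. (if snd p then snd else fst) (g (fst p))) (i, False),
      (\<lambda>p\<in>positions M. (if snd p then snd else fst) (g (fst p))) (i, True))) = g"
    by (auto simp: positions_def fun_eq_iff PiE_def extensional_def)
  show "(\<lambda>w. \<lambda>i\<in>{..<M}. (w (i, False), w (i, True))) ` (positions M \<rightarrow>\<^sub>E V) \<subseteq> {..<M} \<rightarrow>\<^sub>E V \<times> V"
    by (auto simp: positions_def PiE_def Pi_def)
  show "(\<lambda>g. \<lambda>p\<in>positions M. (if snd p then snd else fst) (g (fst p))) ` ({..<M} \<rightarrow>\<^sub>E V \<times> V) \<subseteq> positions M \<rightarrow>\<^sub>E V"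
    by (fastforce simp: positions_def PiE_def Pi_def)
qed

text \<open>Saddle-point bound: a pair of positions labelled \<open>0\<close>, \<open>1\<close>, \<open>2\<close>, but not \<open>{1, 2}\<close>, has total
  weight \<open>1 + 4 x + 2 x\<^sup>2\<close> when the labels \<open>1\<close> and \<open>2\<close> have weight \<open>x\<close>.\<close>

lemma card_avoiding_pairs_le:
  fixes x :: real
  assumes "x \<ge> 0"
  shows "real (card {y \<in> disjoint_pairs (positions M) s. case_prod (avoids M) y}) * x ^ (2 * s) \<le>
    (1 + 4 * x + 2 * x\<^sup>2) ^ M"
proof -
  let ?D = "{y \<in> disjoint_pairs (positions M) s. case_prod (avoids M) y}"
  \<comment> \<open>Labels \<open>1\<close> and \<open>2\<close> mark the first and the second set;
    of the nine pairs of labels only \<open>(1, 2)\<close> and \<open>(2, 1)\<close> are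
    missing.\<close>
  define Q where "Q = {(0::nat, 0::nat), (0, 1), (0, 2), (1, 0), (1, 1), (2, 0), (2, 2)}"
  define z where "z j = (if j = 0 then 1 else x)" for j :: nat
  let ?c = "\<lambda>y :: (nat \<times> bool) set \<times> (nat \<times> bool) set. \<lambda>p. if p \<in> fst y then 1 else if p \<in> snd y then 2 else (0::nat)"
  define g where "g y = (\<lambda>i\<in>{..<M}. (?c y (i, False), ?c y (i, True)))" for y
  define W where "W h = (\<Prod>i<M. z (fst (h i)) * z (snd (h i)))" for h
  have g_mem: "g y \<in> {..<M} \<rightarrow>\<^sub>E Q" if "y \<in> ?D" for y
  proof -
    obtain A B where y: "y = (A, B)" by fastforce
    have "avoids M A B" "A \<inter> B = {}" using that y by (auto simp: disjoint_pairs_def)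
    then have "(?c y (i, False), ?c y (i, True)) \<in> Q" if "i < M" for i
      using that unfolding avoids_def Q_def y by auto (metis (full_types))+
    then show ?thesis by (auto simp: g_def)
  qed
  have inj: "inj_on g ?D"
  proof (rule inj_onI)
    fix y y' assume yy: "y \<in> ?D" "y' \<in> ?D" "g y = g y'"
    have "?c y p = ?c y' p" if "p \<in> positions M" for p
    proof -
      obtain i b where p: "p = (i, b)" "i < M" using \<open>p \<in> positions M\<close> by (cases p) (auto simp: positions_def)
      have "?c y (i, False) = ?c y' (i, False)" "?c y (i, True) = ?c y' (i, True)"
        using fun_cong[OF yy(3), of i] p(2) by (simp_all add: g_def del: One_nat_def)
      then have "?c y (i, b) = ?c y' (i, b)"
        by - (rule bool.induct[where P = "\<lambda>b. ?c y (i, b) = ?c y' (i, b)"], assumption+)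
      then show ?thesis by (simp only: p(1))
    qed
    note same = this
    have *: "p \<in> fst y \<longleftrightarrow> p \<in> fst y'" "p \<in> fst y \<or> p \<in> snd y \<longleftrightarrow> p \<in> fst y' \<or> p \<in> snd y'" if "p \<in> positions M" for p
    proof -
      have "p \<in> fst y \<longleftrightarrow> ?c y p = 1" "p \<in> fst y' \<longleftrightarrow> ?c y' p = 1" by simp_all
      then show "p \<in> fst y \<longleftrightarrow> p \<in> fst y'" using same[OF that] by metis
      have "p \<in> fst y \<or> p \<in> snd y \<longleftrightarrow> ?c y p \<noteq> 0" "p \<in> fst y' \<or> p \<in> snd y' \<longleftrightarrow> ?c y' p \<noteq> 0" by simp_all
      then show "p \<in> fst y \<or> p \<in> snd y \<longleftrightarrow> p \<in> fst y' \<or> p \<in> snd y'" using same[OF that] by metis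
    qed
    have sub: "fst y \<subseteq> positions M" "snd y \<subseteq> positions M" "fst y' \<subseteq> positions M" "snd y' \<subseteq> positions M"
      "fst y \<inter> snd y = {}" "fst y' \<inter> snd y' = {}"
      using yy by (auto simp: disjoint_pairs_def)
    have "fst y = fst y'" using *(1) sub by blast
    moreover have "snd y = snd y'" using *(2) sub \<open>fst y = fst y'\<close> by blast
    ultimately show "y = y'" by (simp add: prod_eq_iff)
  qed
  have weight: "W (g y) = x ^ (2 * s)" if "y \<in> ?D" for y
  proof -
    obtain A B where y: "y = (A, B)" by fastforce
    have AB: "A \<subseteq> positions M" "B \<subseteq> positions M" "A \<inter> B = {}" "card A = s" "card B = s"
      using that y by (auto simp: disjoint_pairs_def)
    have fin: "finite A" "finite B" using AB finite_subset finite_positions by metis+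
    have "W (g y) = (\<Prod>i<M. \<Prod>b\<in>UNIV. z (?c y (i, b)))"
      unfolding W_def g_def by (intro prod.cong) (simp_all add: UNIV_bool)
    also have "\<dots> = (\<Prod>p\<in>positions M. z (?c y p))"
      unfolding prod.cartesian_product positions_def by (intro prod.cong refl) (auto simp del: One_nat_def)
    also have "\<dots> = (\<Prod>p\<in>A \<union> B. x)"
      using AB by (intro prod.mono_neutral_cong_right) (auto simp: z_def y)
    finally show ?thesis using AB fin by (simp add: card_Un_disjoint mult_2)
  qed
  have Wnn: "W h \<ge> 0" for h unfolding W_def z_def using assms by (intro prod_nonneg) auto
  have finP: "finite ({..<M} \<rightarrow>\<^sub>E Q)" by (intro finite_PiE) (auto simp: Q_def)
  have "real (card ?D) * x ^ (2 * s) = (\<Sum>y\<in>?D. W (g y))" using weight by simp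
  also have "\<dots> = (\<Sum>h\<in>g ` ?D. W h)" using inj by (simp add: sum.reindex)
  \<comment> \<open>Forgetting the sizes of the two sets makes the sum factor over the pairs
    \<open>i\<close>.\<close>
  also have "\<dots> \<le> (\<Sum>h\<in>{..<M} \<rightarrow>\<^sub>E Q. W h)"
    using g_mem Wnn finP by (intro sum_mono2) auto
  also have "\<dots> = (\<Prod>i<M. \<Sum>q\<in>Q. z (fst q) * z (snd q))"
    unfolding W_def by (rule prod_sum_PiE[symmetric]) (auto simp: Q_def)
  also have "(\<Sum>q\<in>Q. z (fst q) * z (snd q)) = 1 + 4 * x + 2 * x\<^sup>2"
    by (simp add: Q_def z_def power2_eq_square)
  finally show ?thesis by simp
qed

section \<open>Loops and multiple edges\<close>

text \<open>The switching method, as double counting of \<open>(x, s)\<close>: each \<open>x\<close>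
  admits at least \<open>a\<close> switchings \<open>s\<close>, and \<open>x\<close> is recovered
  from the result and \<open>s\<close>, where the result leaves at most \<open>b\<close> candidates
  for \<open>s\<close>.\<close>

lemma card_mult_le_by_injection:
  fixes f :: "'a \<Rightarrow> 's \<Rightarrow> 'b"
  assumes "finite X" "finite Y" and P: "\<And>x. x \<in> X \<Longrightarrow> finite (P x) \<and> a \<le> card (P x)"
    and mem: "\<And>x s. x \<in> X \<Longrightarrow> s \<in> P x \<Longrightarrow> f x s \<in> Y"
    and inj: "\<And>x x' s. x \<in> X \<Longrightarrow> x' \<in> X \<Longrightarrow> s \<in> P x \<Longrightarrow> s \<in> P x' \<Longrightarrow> f x s = f x' s \<Longrightarrow> x = x'"
    and B: "\<And>y. y \<in> Y \<Longrightarrow> finite (B y) \<and> card (B y) \<le> b"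
    and s_mem: "\<And>x s. x \<in> X \<Longrightarrow> s \<in> P x \<Longrightarrow> s \<in> B (f x s)"
  shows "a * card X \<le> b * card Y"
proof -
  have "a * card X = (\<Sum>x\<in>X. a)" by simp
  also have "\<dots> \<le> (\<Sum>x\<in>X. card (P x))" using P by (intro sum_mono) auto
  also have "\<dots> = card (Sigma X P)" using assms(1) P by simp
  also have "\<dots> \<le> card (Sigma Y B)"
  proof (rule card_inj_on_le[of "\<lambda>(x, s). (f x s, s)"])
    show "inj_on (\<lambda>(x, s). (f x s, s)) (Sigma X P)" using inj by (auto simp: inj_on_def)
    show "(\<lambda>(x, s). (f x s, s)) ` Sigma X P \<subseteq> Sigma Y B" using mem s_mem by auto
    show "finite (Sigma Y B)" using assms(2) B by auto
  qed
  also have "\<dots> = (\<Sum>y\<in>Y. card (B y))" using assms(2) B by simp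
  also have "\<dots> \<le> (\<Sum>y\<in>Y. b)" using B by (intro sum_mono) auto
  finally show ?thesis by (simp add: mult.commute)
qed

lemma words_transpose:
  assumes "w \<in> words N M d" "p \<in> positions M" "q \<in> positions M"
  shows "w \<circ> Transposition.transpose p q \<in> words N M d"
proof -
  have "bij_betw (Transposition.transpose p q) (positions M) (positions M)" using assms by simp
  from words_permute[OF assms(1) this]
  have "restrict (w \<circ> Transposition.transpose p q) (positions M) \<in> words N M d" .
  moreover have "restrict (w \<circ> Transposition.transpose p q) (positions M) = w \<circ> Transposition.transpose p q"
    using assms by (auto simp: fun_eq_iff restrict_def words_def PiE_def extensional_def Transposition.transpose_def)
  ultimately show ?thesis by simp
qed

lemma comp_transpose_cancel: "u \<circ> Transposition.transpose p q = w \<circ> Transposition.transpose p q \<Longrightarrow> u = w"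
  by (metis comp_assoc comp_id transpose_comp_involutory)

lemma card_letter: "w \<in> words N M d \<Longrightarrow> v < N \<Longrightarrow> card {p \<in> positions M. w p = v} = d"
  by (simp add: words_def)

text \<open>Both counts below move the offending letters to arbitrary positions by transpositions; the
  targets can be guessed among \<open>d\<close> positions from the resulting word.\<close>

lemma card_words_loop:
  assumes "i < M"
  shows "(2 * M - 2) * card {w \<in> words N M d. w (i, False) = w (i, True)} \<le> d * card (words N M d)"
\<comment> \<open>The end \<open>(i, False)\<close> is untouched and still shows the letter that was
  moved to \<open>p\<close>.\<close>
proof (rule card_mult_le_by_injection[where f = "\<lambda>w p. w \<circ> Transposition.transpose (i, True) p" and
      P = "\<lambda>_. positions M - {(i, False), (i, True)}" and B = "\<lambda>y. {p \<in> positions M. y p = y (i, False)}"], goal_cases)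
  case 3
  have "{(i, False), (i, True)} \<subseteq> positions M" using assms by (auto simp: positions_def)
  then show ?case by (simp add: card_Diff_subset)
next
  case (4 w p)
  then show ?case using assms by (intro words_transpose) (auto simp: positions_def)
next
  case (5 u w p)
  show ?case by (rule comp_transpose_cancel[OF 5(5)])
next
  case (6 y)
  then show ?case using assms card_letter words_less by (fastforce simp: positions_def)
qed (auto simp: Transposition.transpose_def)

lemma comp_transpose_transpose_apply:
  assumes "distinct [a, a', p, q]"
  shows "(w \<circ> Transposition.transpose a p \<circ> Transposition.transpose a' q) p = w a"
    and "(w \<circ> Transposition.transpose a p \<circ> Transposition.transpose a' q) q = w a'"
    and "u \<notin> {a, a', p, q} \<Longrightarrow> (w \<circ> Transposition.transpose a p \<circ> Transposition.transpose a' q) u = w u"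
  using assms by (auto simp: Transposition.transpose_def)

lemma card_words_parallel:
  assumes "i < M" "j < M" "i \<noteq> j"
  shows "((2 * M - 4) * (2 * M - 5)) * card {w \<in> words N M d. w (i, False) = w (j, b) \<and> w (i, True) = w (j, \<not> b)}
    \<le> (d * d) * card (words N M d)"
\<comment> \<open>Pair \<open>i\<close> is untouched and shows both letters moved away from pair
  \<open>j\<close>. The targets are distinct and avoid both pairs, whence the factors
  \<open>2 * M - 4\<close> and \<open>2 * M - 5\<close>.\<close>
proof (rule card_mult_le_by_injection[where f = "\<lambda>w s. w \<circ> Transposition.transpose (j, b) (fst s) \<circ> Transposition.transpose (j, \<not> b) (snd s)" and
      P = "\<lambda>_. SIGMA p : positions M - {(i, False), (i, True), (j, b), (j, \<not> b)}.
               positions M - {(i, False), (i, True), (j, b), (j, \<not> b), p}" and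
      B = "\<lambda>y. {p \<in> positions M. y p = y (i, False)} \<times> {p \<in> positions M. y p = y (i, True)}"], goal_cases)
  case 3
  let ?F = "{(i, False), (i, True), (j, b), (j, \<not> b)}"
  have F: "?F \<subseteq> positions M" "card ?F = 4" using assms by (auto simp: positions_def)
  then have 1: "card (positions M - ?F) = 2 * M - 4" by (simp add: card_Diff_subset)
  have "card (positions M - {(i, False), (i, True), (j, b), (j, \<not> b), p}) = 2 * M - 5"
    if p: "p \<in> positions M - ?F" for p
  proof -
    have "positions M - {(i, False), (i, True), (j, b), (j, \<not> b), p} = (positions M - ?F) - {p}" by auto
    then show ?thesis using p 1 by simp
  qed
  then show ?case using 1 by simp
next
  case (4 w s)
  have "(j, b') \<in> positions M" for b' using assms(2) by (simp add: positions_def)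
  moreover obtain p q where "s = (p, q)" "p \<in> positions M" "q \<in> positions M"
    using 4(2) by blast
  moreover have "w \<in> words N M d" using 4(1) by blast
  ultimately show ?case by (simp only: fst_conv snd_conv words_transpose)
next
  case (5 u w s)
  show ?case by (rule comp_transpose_cancel[OF comp_transpose_cancel[OF 5(5)]])
next
  case (6 y)
  then show ?case using assms card_letter words_less by (fastforce simp: positions_def card_cartesian_product)
next
  case (7 w s)
  obtain p q where "s = (p, q)" "p \<in> positions M - {(i, False), (i, True), (j, b), (j, \<not> b)}"
    "q \<in> positions M - {(i, False), (i, True), (j, b), (j, \<not> b), p}"
    using 7(2) by blast
  moreover have "w (i, False) = w (j, b)" "w (i, True) = w (j, \<not> b)" using 7(1) by blast+
  moreover from calculation have dist: "distinct [(j, b), (j, \<not> b), p, q]"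
    and other: "(i, b') \<notin> {(j, b), (j, \<not> b), p, q}" for b'
    using assms(3) by (cases b'; auto)+
  note apply_swaps = comp_transpose_transpose_apply(1,2)[OF dist] comp_transpose_transpose_apply(3)[OF dist other]
  ultimately show ?case by (simp only: fst_conv snd_conv mem_Times_iff mem_Collect_eq apply_swaps) simp
qed auto

section \<open>The average number of bad pairs\<close>

definition bad_pairs :: "nat \<Rightarrow> (nat \<times> bool \<Rightarrow> nat) \<Rightarrow> nat set" where
  "bad_pairs M w = {i. i < M \<and> (w (i, False) = w (i, True) \<or>
     (\<exists>j<M. j \<noteq> i \<and> (\<exists>b. w (i, False) = w (j, b) \<and> w (i, True) = w (j, \<not> b))))}"

lemma finite_bad_pairs [simp]: "finite (bad_pairs M w)"
  by (simp add: bad_pairs_def)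

text \<open>Linearity of expectation: pair \<open>i\<close> is a loop in at most a fraction d / M of
  the words, and parallel to a given \<open>j\<close> in at most d^2 / M^2 for each of two
  orientations. Summing over \<open>j\<close> and then over the M pairs removes M from the
  bound.\<close>

lemma sum_card_bad_pairs:
  assumes "M \<ge> 5"
  shows "(\<Sum>w\<in>words N M d. card (bad_pairs M w)) \<le> (d + 2 * d * d) * card (words N M d)"
proof -
  let ?W = "words N M d"
  define L where "L i = card {w \<in> ?W. w (i, False) = w (i, True)}" for i
  define Q where "Q i j b = card {w \<in> ?W. w (i, False) = w (j, b) \<and> w (i, True) = w (j, \<not> b)}" for i j b
  have L: "M * L i \<le> d * card ?W" if "i < M" for i
  proof -
    have "M * L i \<le> (2 * M - 2) * L i" using assms by (intro mult_right_mono) auto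
    also have "\<dots> \<le> d * card ?W" using card_words_loop[OF that, of N d] by (simp only: L_def)
    finally show ?thesis .
  qed
  have Q: "M * M * Q i j b \<le> d * d * card ?W" if "i < M" "j < M" "j \<noteq> i" for i j b
  proof -
    \<comment> \<open>This fails for \<open>M = 4\<close>, which explains the bound
      \<open>5\<close>.\<close>
    have "M * M \<le> (2 * M - 4) * (2 * M - 5)"
    proof -
      obtain t where "M = t + 5" using assms by (metis add.commute le_Suc_ex)
      then show ?thesis by (simp add: algebra_simps)
    qed
    then have "M * M * Q i j b \<le> (2 * M - 4) * (2 * M - 5) * Q i j b" by (rule mult_right_mono) simp
    also have "\<dots> \<le> d * d * card ?W" using card_words_parallel[of i M j N d b] that by (simp add: Q_def)
    finally show ?thesis .
  qed
  have fibre: "card {w \<in> ?W. i \<in> bad_pairs M w} \<le> L i + (\<Sum>j\<in>{..<M} - {i}. Q i j False + Q i j True)" if "i < M" for i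
  proof -
    let ?A = "{w \<in> ?W. w (i, False) = w (i, True)}"
    let ?B = "\<lambda>j b. {w \<in> ?W. w (i, False) = w (j, b) \<and> w (i, True) = w (j, \<not> b)}"
    have "{w \<in> ?W. i \<in> bad_pairs M w} \<subseteq> ?A \<union> (\<Union>j\<in>{..<M} - {i}. ?B j False \<union> ?B j True)"
      unfolding bad_pairs_def by (auto simp: ex_bool_eq)
    then have "card {w \<in> ?W. i \<in> bad_pairs M w} \<le> card (?A \<union> (\<Union>j\<in>{..<M} - {i}. ?B j False \<union> ?B j True))"
      by (rule card_mono[rotated]) simp
    also have "\<dots> \<le> card ?A + card (\<Union>j\<in>{..<M} - {i}. ?B j False \<union> ?B j True)" by (rule card_Un_le)
    also have "\<dots> \<le> card ?A + (\<Sum>j\<in>{..<M} - {i}. card (?B j False \<union> ?B j True))"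
      by (intro add_left_mono card_UN_le) simp
    also have "\<dots> \<le> card ?A + (\<Sum>j\<in>{..<M} - {i}. card (?B j False) + card (?B j True))"
      by (intro add_left_mono sum_mono card_Un_le)
    finally show ?thesis by (simp add: L_def Q_def)
  qed
  have each: "M * card {w \<in> ?W. i \<in> bad_pairs M w} \<le> (d + 2 * d * d) * card ?W" if i: "i < M" for i
  proof -
    have "M * (M * card {w \<in> ?W. i \<in> bad_pairs M w})
      \<le> M * (M * L i) + (\<Sum>j\<in>{..<M} - {i}. M * M * Q i j False + M * M * Q i j True)"
    proof -
      have "M * (M * card {w \<in> ?W. i \<in> bad_pairs M w}) \<le> M * (M * (L i + (\<Sum>j\<in>{..<M} - {i}. Q i j False + Q i j True)))"
        using fibre[OF i] by (intro mult_left_mono) auto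
      then show ?thesis by (simp add: algebra_simps sum_distrib_left sum.distrib)
    qed
    also have "\<dots> \<le> M * (d * card ?W) + (\<Sum>j\<in>{..<M} - {i}. d * d * card ?W + d * d * card ?W)"
      using L[OF i] Q[OF i] by (intro add_mono mult_left_mono sum_mono) auto
    also have "\<dots> \<le> M * (d * card ?W) + M * (d * d * card ?W + d * d * card ?W)"
      using i by (simp add: mult_right_mono)
    also have "\<dots> = M * ((d + 2 * d * d) * card ?W)" by (simp add: algebra_simps)
    finally show ?thesis using assms by simp
  qed
  have "(\<Sum>w\<in>?W. card (bad_pairs M w)) = (\<Sum>w\<in>?W. \<Sum>i<M. if i \<in> bad_pairs M w then 1 else 0)"
  proof (rule sum.cong[OF refl])
    fix w
    have "{..<M} \<inter> bad_pairs M w = bad_pairs M w" by (auto simp: bad_pairs_def)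
    then show "card (bad_pairs M w) = (\<Sum>i<M. if i \<in> bad_pairs M w then 1 else 0)"
      by (simp add: sum.If_cases)
  qed
  also have "\<dots> = (\<Sum>i<M. \<Sum>w\<in>?W. if i \<in> bad_pairs M w then 1 else 0)" by (rule sum.swap)
  also have "\<dots> = (\<Sum>i<M. card {w \<in> ?W. i \<in> bad_pairs M w})"
    by (intro sum.cong refl) (simp add: sum.If_cases Int_def)
  finally have "M * (\<Sum>w\<in>?W. card (bad_pairs M w)) = (\<Sum>i<M. M * card {w \<in> ?W. i \<in> bad_pairs M w})"
    by (simp add: sum_distrib_left)
  also have "\<dots> \<le> (\<Sum>i<M. (d + 2 * d * d) * card ?W)" using each by (intro sum_mono) auto
  finally show ?thesis using assms by simp
qed

text \<open>Markov's inequality at twice the mean.\<close>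

lemma card_few_bad_pairs:
  assumes "M \<ge> 5" "K = 2 * (d + 2 * d * d)"
  shows "card (words N M d) \<le> 2 * card {w \<in> words N M d. card (bad_pairs M w) \<le> K}"
proof -
  let ?W = "words N M d"
  let ?H = "{w \<in> ?W. card (bad_pairs M w) > K}" and ?L = "{w \<in> ?W. card (bad_pairs M w) \<le> K}"
  have "card ?H * (K + 1) = (\<Sum>w\<in>?H. K + 1)" by simp
  also have "\<dots> \<le> (\<Sum>w\<in>?H. card (bad_pairs M w))" by (intro sum_mono) auto
  also have "\<dots> \<le> (\<Sum>w\<in>?W. card (bad_pairs M w))" by (intro sum_mono2) auto
  also have "\<dots> \<le> (d + 2 * d * d) * card ?W" by (rule sum_card_bad_pairs[OF assms(1)])
  finally have "2 * card ?H * (K + 1) \<le> card ?W * K" using assms(2) by (simp add: algebra_simps)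
  also have "\<dots> \<le> card ?W * (K + 1)" by simp
  finally have "2 * card ?H \<le> card ?W" by (simp only: mult_le_cancel2)
  moreover have "card ?W = card ?H + card ?L"
    by (subst card_Un_disjoint[symmetric]) (auto intro!: arg_cong[where f = card])
  ultimately show ?thesis by linarith
qed

section \<open>Removing bad pairs by transpositions\<close>

lemma positions_iff [simp]: "(i, b) \<in> positions M \<longleftrightarrow> i < M"
  by (simp add: positions_def)

lemma bad_pairs_parallel_sym:
  assumes "l < M" "m < M" "m \<noteq> l" "w (l, False) = w (m, b)" "w (l, True) = w (m, \<not> b)"
  shows "m \<in> bad_pairs M w"
proof -
  have "w (m, False) = w (l, b) \<and> w (m, True) = w (l, \<not> b)" using assms(4,5) by (cases b) simp_all
  then show ?thesis using assms(1-3) unfolding bad_pairs_def by blast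
qed

text \<open>The swap turns pairs \<open>i\<close> and \<open>j\<close> into the pair of their first
  ends and the pair of their second ends. By the hypotheses these are not loops, not parallel to
  each other and not parallel to an old pair. So \<open>i\<close> and \<open>j\<close> become good,
  and no other pair becomes bad.\<close>

lemma bad_pairs_transpose_subset:
  fixes w :: "nat \<times> bool \<Rightarrow> nat"
  assumes ij: "i < M" "j < M" "i \<noteq> j"
    and i_loop: "w (i, False) \<noteq> w (j, False)" and j_loop: "w (i, True) \<noteq> w (j, True)"
    and ij_parallel: "\<not> (w (i, False) = w (j, True) \<and> w (j, False) = w (i, True))"
      "\<not> (w (i, False) = w (i, True) \<and> w (j, False) = w (j, True))"
    and i_parallel: "\<And>l b. l < M \<Longrightarrow> \<not> (w (l, b) = w (i, False) \<and> w (l, \<not> b) = w (j, False))"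
    and j_parallel: "\<And>l b. l < M \<Longrightarrow> \<not> (w (l, b) = w (i, True) \<and> w (l, \<not> b) = w (j, True))"
  shows "bad_pairs M (w \<circ> Transposition.transpose (i, True) (j, False)) \<subseteq> bad_pairs M w - {i}"
proof
  let ?u = "w \<circ> Transposition.transpose (i, True) (j, False)"
  have u: "?u (i, False) = w (i, False)" "?u (i, True) = w (j, False)"
    "?u (j, False) = w (i, True)" "?u (j, True) = w (j, True)"
    "\<And>l b. l \<noteq> i \<Longrightarrow> l \<noteq> j \<Longrightarrow> ?u (l, b) = w (l, b)"
    using ij by (auto simp: Transposition.transpose_def)
  have not_i: "i \<notin> bad_pairs M ?u"
  proof
    assume "i \<in> bad_pairs M ?u"
    then consider "?u (i, False) = ?u (i, True)" | l b where "l < M" "l \<noteq> i" "?u (i, False) = ?u (l, b)" "?u (i, True) = ?u (l, \<not> b)"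
      unfolding bad_pairs_def by blast
    then show False
    proof cases
      case 1
      then show ?thesis using u i_loop by simp
    next
      case (2 l b)
      show ?thesis
      proof (cases "l = j")
        case True
        then show ?thesis using 2 u ij_parallel by (cases b) (auto simp del: o_apply)
      next
        case False
        then show ?thesis using 2 u i_parallel[of l b] by (simp del: o_apply)
      qed
    qed
  qed
  have not_j: "j \<notin> bad_pairs M ?u"
  proof
    assume "j \<in> bad_pairs M ?u"
    then consider "?u (j, False) = ?u (j, True)" | l b where "l < M" "l \<noteq> j" "?u (j, False) = ?u (l, b)" "?u (j, True) = ?u (l, \<not> b)"
      unfolding bad_pairs_def by blast
    then show False
    proof cases
      case 1
      then show ?thesis using u j_loop by simp
    next
      case (2 l b)
      show ?thesis
      proof (cases "l = i")
        case True
        then show ?thesis using 2 u ij_parallel by (cases b) (auto simp del: o_apply)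
      next
        case False
        then show ?thesis using 2 u j_parallel[of l b] by (simp del: o_apply)
      qed
    qed
  qed
  fix l assume l: "l \<in> bad_pairs M ?u"
  have lM: "l < M" using l unfolding bad_pairs_def by blast
  have li: "l \<noteq> i" and lj: "l \<noteq> j" using l not_i not_j by blast+
  from l consider "?u (l, False) = ?u (l, True)" | m b where "m < M" "m \<noteq> l" "?u (l, False) = ?u (m, b)" "?u (l, True) = ?u (m, \<not> b)"
    unfolding bad_pairs_def by blast
  then have "l \<in> bad_pairs M w"
  proof cases
    case 1
    then show ?thesis using lM u(5)[OF li lj] by (simp add: bad_pairs_def del: o_apply)
  next
    case (2 m b)
    \<comment> \<open>The partner \<open>m\<close> is bad as well, hence neither \<open>i\<close>
      nor \<open>j\<close>; so the coincidence involves unchanged letters only.\<close>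
    have "m \<in> bad_pairs M ?u" using bad_pairs_parallel_sym[OF lM 2] .
    then have m: "m \<noteq> i" "m \<noteq> j" using not_i not_j by blast+
    have "w (l, False) = w (m, b) \<and> w (l, True) = w (m, \<not> b)"
      using 2 by (simp only: u(5)[OF li lj] u(5)[OF m])
    then show ?thesis using 2 lM unfolding bad_pairs_def by blast
  qed
  then show "l \<in> bad_pairs M w - {i}" using li by blast
qed

text \<open>Pair \<open>i\<close> is switched with a good pair \<open>j\<close> that has no letter
  equal or adjacent to a letter of \<open>i\<close>. The letters of \<open>i\<close> occupy at most
  \<open>2 * d\<close> positions, so at most \<open>2 * d + 2\<close> letters, on at most
  \<open>d * (2 * d + 2)\<close> positions, are forbidden; the bound on \<open>M\<close> leaves some
  \<open>j\<close>.\<close>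

lemma exists_reducing_transposition:
  assumes w: "w \<in> words N M d" and i: "i \<in> bad_pairs M w"
    and M: "M > card (bad_pairs M w) + d * (2 * d + 2)"
  shows "\<exists>p\<in>positions M. \<exists>q\<in>positions M. card (bad_pairs M (w \<circ> Transposition.transpose p q)) < card (bad_pairs M w)"
proof -
  have iM: "i < M" using i by (simp add: bad_pairs_def)
  let ?a = "w (i, False)" and ?b = "w (i, True)"
  define near where "near = {?a, ?b} \<union> (\<lambda>(l, c). w (l, \<not> c)) ` {p \<in> positions M. w p \<in> {?a, ?b}}"
  have ab: "?a < N" "?b < N" using words_less[OF w] iM by auto
  then have "card {p \<in> positions M. w p \<in> {?a, ?b}} = d * card {?a, ?b}"
    by (intro card_positions_letters[OF w]) auto
  also have "\<dots> \<le> d * 2" by (intro mult_left_mono) (auto simp: card_insert_if)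
  finally have "card ((\<lambda>(l, c). w (l, \<not> c)) ` {p \<in> positions M. w p \<in> {?a, ?b}}) \<le> 2 * d"
    using card_image_le[of "{p \<in> positions M. w p \<in> {?a, ?b}}" "\<lambda>(l, c). w (l, \<not> c)"] by simp
  moreover have "card {?a, ?b} \<le> 2" by (auto simp: card_insert_if)
  ultimately have near_card: "card near \<le> 2 * d + 2"
    unfolding near_def by (intro order_trans[OF card_Un_le]) simp
  have near_sub: "near \<subseteq> {..<N}"
    using words_less[OF w] ab by (auto simp: near_def)
  define E where "E = bad_pairs M w \<union> fst ` {p \<in> positions M. w p \<in> near}"
  have "card (fst ` {p \<in> positions M. w p \<in> near}) \<le> card {p \<in> positions M. w p \<in> near}"
    by (rule card_image_le) simp
  also have "\<dots> = d * card near" by (rule card_positions_letters[OF w near_sub])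
  also have "\<dots> \<le> d * (2 * d + 2)" using near_card by (rule mult_left_mono) simp
  finally have "card E \<le> card (bad_pairs M w) + d * (2 * d + 2)"
    unfolding E_def by (intro order_trans[OF card_Un_le]) simp
  then have "card E < card {..<M}" using M by simp
  moreover have "finite E" unfolding E_def by simp
  ultimately have "\<not> {..<M} \<subseteq> E" using card_mono leD by metis
  then obtain j where j: "j < M" "j \<notin> E" by blast
  have far: "w (j, c) \<notin> near" for c
    using j unfolding E_def by (metis (mono_tags, lifting) UnI2 fst_conv image_eqI mem_Collect_eq positions_iff)
  have "j \<notin> bad_pairs M w" using j unfolding E_def by blast
  then have noloop: "w (j, False) \<noteq> w (j, True)" using j unfolding bad_pairs_def by blast
  have nbr: "w (l, \<not> c) \<in> near" if "l < M" "w (l, c) \<in> {?a, ?b}" for l c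
    using that unfolding near_def by (intro UnI2 image_eqI[of _ _ "(l, c)"]) auto
  have ab_near: "?a \<in> near" "?b \<in> near" by (auto simp: near_def)
  have "bad_pairs M (w \<circ> Transposition.transpose (i, True) (j, False)) \<subseteq> bad_pairs M w - {i}"
  proof (rule bad_pairs_transpose_subset[OF iM j(1)])
    show "i \<noteq> j" using far ab_near by metis
    show "w (i, False) \<noteq> w (j, False)" "w (i, True) \<noteq> w (j, True)" using far ab_near by metis+
    show "\<not> (w (i, False) = w (j, True) \<and> w (j, False) = w (i, True))" using far ab_near by metis
    show "\<not> (w (i, False) = w (i, True) \<and> w (j, False) = w (j, True))" using noloop by simp
    show "\<not> (w (l, c) = w (i, False) \<and> w (l, \<not> c) = w (j, False))" if "l < M" for l c
      using nbr[OF that, of c] far by auto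
    show "\<not> (w (l, c) = w (i, True) \<and> w (l, \<not> c) = w (j, True))" if "l < M" for l c
      using nbr[OF that, of c] far by auto
  qed
  then have "card (bad_pairs M (w \<circ> Transposition.transpose (i, True) (j, False))) \<le> card (bad_pairs M w - {i})"
    by (rule card_mono[rotated]) simp
  also have "\<dots> < card (bad_pairs M w)" using i by (intro psubset_card_mono) auto
  finally show ?thesis using iM j(1) by (intro bexI[of _ "(i, True)"] bexI[of _ "(j, False)"]) auto
qed

text \<open>A reducing transposition is given by one of \<open>(2 * M)^2\<close> pairs of positions,
  and undoing it recovers the word. The summand \<open>1\<close> accounts for words with at most
  \<open>b\<close> bad pairs already.\<close>

lemma card_words_bad_pairs_Suc:
  assumes M: "M > Suc b + d * (2 * d + 2)"
  shows "card {w \<in> words N M d. card (bad_pairs M w) \<le> Suc b} \<le>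
    (4 * M\<^sup>2 + 1) * card {w \<in> words N M d. card (bad_pairs M w) \<le> b}"
proof -
  let ?X = "{w \<in> words N M d. card (bad_pairs M w) = Suc b}" and ?Y = "{w \<in> words N M d. card (bad_pairs M w) \<le> b}"
  let ?f = "\<lambda>w s. w \<circ> Transposition.transpose (fst s) (snd s)"
  let ?P = "\<lambda>w. {s \<in> positions M \<times> positions M. card (bad_pairs M (?f w s)) \<le> b}"
  have "1 * card ?X \<le> (4 * M\<^sup>2) * card ?Y"
  proof (rule card_mult_le_by_injection[where f = ?f and P = ?P and B = "\<lambda>_. positions M \<times> positions M"], goal_cases)
    case (3 w)
    then have "bad_pairs M w \<noteq> {}" by auto
    then obtain i where "i \<in> bad_pairs M w" by blast
    then obtain p q where "p \<in> positions M" "q \<in> positions M"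
      "card (bad_pairs M (w \<circ> Transposition.transpose p q)) < card (bad_pairs M w)"
      using exists_reducing_transposition[of w N M d i] 3 M by auto
    then have "(p, q) \<in> ?P w" using 3 by simp
    moreover have fin: "finite (?P w)" by simp
    ultimately show ?case by (metis (no_types, lifting) One_nat_def Suc_leI card_gt_0_iff empty_iff)
  next
    case (4 w s)
    then show ?case using words_transpose by (simp add: mem_Times_iff)
  next
    case (5 u w s)
    show ?case by (rule comp_transpose_cancel[OF 5(5)])
  next
    case (6 y)
    then show ?case by (simp add: card_cartesian_product power2_eq_square)
  qed auto
  moreover have "{w \<in> words N M d. card (bad_pairs M w) \<le> Suc b} = ?X \<union> ?Y" by auto
  moreover have "card (?X \<union> ?Y) \<le> card ?X + card ?Y" by (rule card_Un_le)
  ultimately show ?thesis by simp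
qed

text \<open>\<open>K\<close> depends on \<open>d\<close> only, so descending from \<open>K\<close>
  bad pairs to none costs a factor polynomial in \<open>M\<close>.\<close>

lemma card_words_le_simple:
  assumes "K = 2 * (d + 2 * d * d)" "M > K + d * (2 * d + 2) + 5"
  shows "card (words N M d) \<le> 2 * (4 * M\<^sup>2 + 1) ^ K * card {w \<in> words N M d. bad_pairs M w = {}}"
proof -
  have "card {w \<in> words N M d. card (bad_pairs M w) \<le> b} \<le> (4 * M\<^sup>2 + 1) ^ b * card {w \<in> words N M d. card (bad_pairs M w) \<le> 0}"
    if "b \<le> K" for b
    using that
  proof (induction b)
    case (Suc b)
    have "card {w \<in> words N M d. card (bad_pairs M w) \<le> Suc b} \<le> (4 * M\<^sup>2 + 1) * card {w \<in> words N M d. card (bad_pairs M w) \<le> b}"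
      using Suc.prems assms(2) by (intro card_words_bad_pairs_Suc) linarith
    also have "\<dots> \<le> (4 * M\<^sup>2 + 1) * ((4 * M\<^sup>2 + 1) ^ b * card {w \<in> words N M d. card (bad_pairs M w) \<le> 0})"
      using Suc by (intro mult_left_mono) auto
    finally show ?case by (simp only: power_Suc mult.assoc)
  qed simp
  from this[OF order.refl] have "card {w \<in> words N M d. card (bad_pairs M w) \<le> K}
    \<le> (4 * M\<^sup>2 + 1) ^ K * card {w \<in> words N M d. bad_pairs M w = {}}" by simp
  moreover have "card (words N M d) \<le> 2 * card {w \<in> words N M d. card (bad_pairs M w) \<le> K}"
    using assms by (intro card_few_bad_pairs) auto
  ultimately show ?thesis by simp
qed

section \<open>From configurations to graphs\<close>

definition pair_edge :: "(nat \<times> bool \<Rightarrow> nat) \<Rightarrow> nat \<Rightarrow> nat set" where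
  "pair_edge w i = {w (i, False), w (i, True)}"

lemma mem_pair_edge_iff: "v \<in> pair_edge w i \<longleftrightarrow> (\<exists>b. w (i, b) = v)"
  by (auto simp: pair_edge_def ex_bool_eq)

definition word_graph :: "nat \<Rightarrow> nat \<Rightarrow> (nat \<times> bool \<Rightarrow> nat) \<Rightarrow> graph" where
  "word_graph N M w = ({..<N}, pair_edge w ` {..<M})"

definition simple_words :: "nat \<Rightarrow> nat \<Rightarrow> nat \<Rightarrow> (nat \<times> bool \<Rightarrow> nat) set" where
  "simple_words N M d = {w \<in> words N M d. bad_pairs M w = {}}"

lemma finite_simple_words [simp]: "finite (simple_words N M d)"
  by (simp add: simple_words_def)

lemma bad_pairs_empty_iff:
  "bad_pairs M w = {} \<longleftrightarrow> (\<forall>i<M. w (i, False) \<noteq> w (i, True)) \<and> inj_on (pair_edge w) {..<M}"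
  (is "_ \<longleftrightarrow> ?R")
proof
  assume empty: "bad_pairs M w = {}"
  have "inj_on (pair_edge w) {..<M}"
  proof (rule inj_onI, rule ccontr)
    fix i j assume ij: "i \<in> {..<M}" "j \<in> {..<M}" "pair_edge w i = pair_edge w j" "i \<noteq> j"
    then have "\<exists>b. w (i, False) = w (j, b) \<and> w (i, True) = w (j, \<not> b)"
      by (auto simp: pair_edge_def doubleton_eq_iff ex_bool_eq)
    then have "i \<in> bad_pairs M w" using ij(1,2,4) unfolding bad_pairs_def by blast
    then show False using empty by blast
  qed
  then show ?R using empty by (auto simp: bad_pairs_def)
next
  assume R: ?R
  have False if i: "i \<in> bad_pairs M w" for i
  proof -
    have iM: "i < M" using i by (simp add: bad_pairs_def)
    then obtain j b where j: "j < M" "j \<noteq> i" "w (i, False) = w (j, b)" "w (i, True) = w (j, \<not> b)"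
      using i R unfolding bad_pairs_def by blast
    have "pair_edge w i = pair_edge w j" using j(3,4) by (cases b) (auto simp: pair_edge_def)
    then show False using R iM j(1,2) by (auto simp: inj_on_def)
  qed
  then show "bad_pairs M w = {}" by blast
qed

text \<open>Without loops a pair contains a letter at most once, and without parallel pairs indices
  correspond to edges.\<close>

lemma card_letter_eq_degree:
  assumes "\<forall>i<M. w (i, False) \<noteq> w (i, True)" "inj_on (pair_edge w) {..<M}"
  shows "card {p \<in> positions M. w p = v} = vertex_degree (word_graph N M w) v"
proof -
  have "inj_on fst {p \<in> positions M. w p = v}"
  proof (rule inj_onI)
    fix p q assume pq: "p \<in> {p \<in> positions M. w p = v}" "q \<in> {p \<in> positions M. w p = v}" "fst p = fst q"
    obtain i b c where "p = (i, b)" "q = (i, c)" using pq(3) by (metis prod.collapse)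
    then show "p = q" using pq(1,2) assms(1) by (cases b; cases c) auto
  qed
  moreover have "fst ` {p \<in> positions M. w p = v} = {i. i < M \<and> v \<in> pair_edge w i}"
  proof (intro subset_antisym subsetI)
    fix i assume "i \<in> {i. i < M \<and> v \<in> pair_edge w i}"
    then obtain b where "i < M" "w (i, b) = v" using mem_pair_edge_iff by blast
    then show "i \<in> fst ` {p \<in> positions M. w p = v}" by (intro image_eqI[of _ _ "(i, b)"]) simp_all
  next
    fix i assume "i \<in> fst ` {p \<in> positions M. w p = v}"
    then obtain b where "(i, b) \<in> positions M" "w (i, b) = v" by force
    then show "i \<in> {i. i < M \<and> v \<in> pair_edge w i}" using mem_pair_edge_iff by auto
  qed
  ultimately have "card {p \<in> positions M. w p = v} = card {i. i < M \<and> v \<in> pair_edge w i}"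
    using card_image[of fst "{p \<in> positions M. w p = v}"] by simp
  also have "\<dots> = card (pair_edge w ` {i. i < M \<and> v \<in> pair_edge w i})"
    using assms(2) by (intro card_image[symmetric] inj_on_subset[OF assms(2)]) auto
  also have "pair_edge w ` {i. i < M \<and> v \<in> pair_edge w i} = {e \<in> edges (word_graph N M w). v \<in> e}"
    by (auto simp: word_graph_def)
  finally show ?thesis by (simp add: vertex_degree_def)
qed

lemma word_graph_regular:
  assumes "w \<in> simple_words N M d"
  shows "word_graph N M w \<in> regular_graphs N d"
proof -
  have w: "w \<in> words N M d" and s: "\<forall>i<M. w (i, False) \<noteq> w (i, True)" "inj_on (pair_edge w) {..<M}"
    using assms bad_pairs_empty_iff by (auto simp: simple_words_def)
  have "vertex_degree (word_graph N M w) v = d" if "v < N" for v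
    using card_letter_eq_degree[OF s] card_letter[OF w that] by simp
  moreover have "pair_edge w i \<in> [{..<N}]\<^bsup>2\<^esup>" if "i < M" for i
    using words_less[OF w, of "(i, False)"] words_less[OF w, of "(i, True)"] s(1) that
    by (simp add: nsets_def pair_edge_def)
  ultimately show ?thesis by (auto simp: regular_graphs_def simple_graph_def word_graph_def)
qed

lemma card_edges_regular_graph:
  assumes "G \<in> regular_graphs N d"
  shows "2 * card (edges G) = d * N"
proof -
  have G: "edges G \<subseteq> [{..<N}]\<^bsup>2\<^esup>" "\<And>v. v < N \<Longrightarrow> card {e \<in> edges G. v \<in> e} = d"
    using assms by (auto simp: regular_graphs_def simple_graph_def vertex_degree_def)
  have fin: "finite (edges G)" using G(1) by (rule finite_subset) (simp add: finite_imp_finite_nsets)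
  have "(\<Sum>v<N. card {e \<in> edges G. v \<in> e}) = 2 * card (edges G)"
  proof (rule sum_multicount[OF _ fin])
    show "\<forall>e\<in>edges G. card {v \<in> {..<N}. v \<in> e} = 2"
    proof
      fix e assume "e \<in> edges G"
      then have "e \<subseteq> {..<N}" "card e = 2" using G(1) by (auto simp: nsets_def)
      moreover from this have "{v \<in> {..<N}. v \<in> e} = e" by auto
      ultimately show "card {v \<in> {..<N}. v \<in> e} = 2" by simp
    qed
  qed simp
  moreover have "(\<Sum>v<N. card {e \<in> edges G. v \<in> e}) = d * N" using G(2) by simp
  ultimately show ?thesis by simp
qed

section \<open>Number of words for each regular graph\<close>

text \<open>If \<open>card E = M\<close>, there are M! of these. What matters is that this number is
  positive and the same for all such \<open>E\<close>, since it cancels.\<close>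

definition labellings :: "nat \<Rightarrow> 'a set \<Rightarrow> (nat \<Rightarrow> 'a) set" where
  "labellings M E = {f \<in> {..<M} \<rightarrow>\<^sub>E E. bij_betw f {..<M} E}"

lemma finite_labellings: "finite E \<Longrightarrow> finite (labellings M E)"
  unfolding labellings_def by (rule finite_subset[of _ "{..<M} \<rightarrow>\<^sub>E E"]) (auto intro: finite_PiE)

lemma card_labellings_le:
  assumes "finite E" "finite E'" "card E = card E'"
  shows "card (labellings M E) \<le> card (labellings M E')"
proof -
  obtain h where h: "bij_betw h E E'" using finite_same_card_bij[OF assms] by blast
  let ?g = "\<lambda>f. \<lambda>i\<in>{..<M}. h (f i)"
  show ?thesis
  proof (rule card_inj_on_le[of ?g])
    show "inj_on ?g (labellings M E)"
    proof (rule inj_onI)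
      fix f f' assume f: "f \<in> labellings M E" "f' \<in> labellings M E" "?g f = ?g f'"
      have "f i = f' i" if "i < M" for i
      proof -
        have "h (f i) = h (f' i)" using fun_cong[OF f(3), of i] that by simp
        moreover have "f i \<in> E" "f' i \<in> E" using f(1,2) that by (auto simp: labellings_def)
        ultimately show ?thesis using h by (auto simp: bij_betw_def inj_on_def)
      qed
      then show "f = f'" using f(1,2)
        by (intro PiE_ext[of f "{..<M}" "\<lambda>_. E" f']) (auto simp: labellings_def)
    qed
    show "?g ` labellings M E \<subseteq> labellings M E'"
    proof (rule image_subsetI)
      fix f assume f: "f \<in> labellings M E"
      then have "bij_betw (h \<circ> f) {..<M} E'" using h by (auto simp: labellings_def intro: bij_betw_trans)
      then have "bij_betw (?g f) {..<M} E'" by (subst bij_betw_cong[of _ _ "h \<circ> f"]) auto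
      then show "?g f \<in> labellings M E'" by (auto simp: labellings_def bij_betw_def)
    qed
    show "finite (labellings M E')" using assms(2) by (rule finite_labellings)
  qed
qed

lemma card_labellings: "finite E \<Longrightarrow> card E = M \<Longrightarrow> card (labellings M E) = card (labellings M {..<M})"
  by (simp add: antisym card_labellings_le)

lemma labellings_nonempty: "restrict id {..<M} \<in> labellings M {..<M}"
  by (auto simp: labellings_def bij_betw_def inj_on_def)

lemma card_orientations:
  assumes f: "f \<in> {..<M} \<rightarrow>\<^sub>E [V]\<^bsup>2\<^esup>"
  shows "card {w \<in> positions M \<rightarrow>\<^sub>E V. restrict (pair_edge w) {..<M} = f} = 2 ^ M"
proof -
  let ?A = "{w \<in> positions M \<rightarrow>\<^sub>E V. restrict (pair_edge w) {..<M} = f}"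
  let ?h = "\<lambda>w. \<lambda>i\<in>{..<M}. (w (i, False), w (i, True))"
  let ?B = "PiE {..<M} (\<lambda>i. {(u, v). {u, v} = f i})"
  have bij: "bij_betw ?h (positions M \<rightarrow>\<^sub>E V) ({..<M} \<rightarrow>\<^sub>E V \<times> V)" by (rule bij_betw_pairs)
  have B_sub: "?B \<subseteq> {..<M} \<rightarrow>\<^sub>E V \<times> V"
  proof (rule PiE_mono)
    fix i assume "i \<in> {..<M}"
    then have "f i \<subseteq> V" using f by (auto simp: nsets_def PiE_def Pi_def)
    then show "{(u, v). {u, v} = f i} \<subseteq> V \<times> V" by auto
  qed
  have mem: "w \<in> ?A \<longleftrightarrow> ?h w \<in> ?B" if "w \<in> positions M \<rightarrow>\<^sub>E V" for w
  proof -
    have "restrict (pair_edge w) {..<M} = f \<longleftrightarrow> (\<forall>i<M. pair_edge w i = f i)"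
    proof
      assume "\<forall>i<M. pair_edge w i = f i"
      then show "restrict (pair_edge w) {..<M} = f" using f by (auto simp: fun_eq_iff PiE_def extensional_def)
    qed auto
    moreover have "?h w \<in> ?B \<longleftrightarrow> (\<forall>i<M. pair_edge w i = f i)"
      by (auto simp: PiE_iff pair_edge_def)
    ultimately show ?thesis using that by (simp only: mem_Collect_eq simp_thms)
  qed
  have "bij_betw ?h ?A ?B"
  proof (rule bij_betw_imageI)
    show "inj_on ?h ?A" by (rule inj_on_subset[OF bij_betw_imp_inj_on[OF bij]]) blast
    show "?h ` ?A = ?B"
    proof (intro subset_antisym subsetI)
      fix g assume g: "g \<in> ?B"
      have "g \<in> ?h ` (positions M \<rightarrow>\<^sub>E V)"
        unfolding bij_betw_imp_surj_on[OF bij] by (rule subsetD[OF B_sub g])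
      then obtain w where w: "g = ?h w" "w \<in> positions M \<rightarrow>\<^sub>E V" by (rule imageE)
      have "w \<in> ?A" unfolding mem[OF w(2)] w(1)[symmetric] by (rule g)
      with w(1) show "g \<in> ?h ` ?A" by (rule image_eqI)
    next
      fix g assume "g \<in> ?h ` ?A"
      then obtain w where w: "g = ?h w" "w \<in> ?A" by (rule imageE)
      then have "w \<in> positions M \<rightarrow>\<^sub>E V" by (simp only: mem_Collect_eq)
      from mem[OF this] w show "g \<in> ?B" by (simp only:)
    qed
  qed
  then have "card ?A = card ?B" by (rule bij_betw_same_card)
  also have "\<dots> = (\<Prod>i<M. card {(u, v). {u, v} = f i})" by (simp add: card_PiE)
  also have "\<dots> = (\<Prod>i<M. 2)"
  proof (rule prod.cong[OF refl])
    fix i assume "i \<in> {..<M}"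
    then have "card (f i) = 2" using f by (auto simp: nsets_def PiE_def Pi_def)
    then obtain a b where ab: "f i = {a, b}" "a \<noteq> b" by (meson card_2_iff)
    then have "{(u, v). {u, v} = f i} = {(a, b), (b, a)}" by (auto simp: doubleton_eq_iff)
    then show "card {(u, v). {u, v} = f i} = 2" using ab(2) by simp
  qed
  finally show ?thesis by simp
qed

text \<open>A word for \<open>G\<close> enumerates the edges and orients each of them. The count is
  independent of \<open>G\<close>, so a uniform simple word gives a uniform regular graph.\<close>

lemma card_word_graph_fibre:
  assumes G: "G \<in> regular_graphs N d" and M: "2 * M = d * N"
  shows "card {w \<in> simple_words N M d. word_graph N M w = G} = card (labellings M {..<M}) * 2 ^ M"
proof -
  have V: "verts G = {..<N}" and E: "edges G \<subseteq> [{..<N}]\<^bsup>2\<^esup>" and deg: "\<And>v. v < N \<Longrightarrow> vertex_degree G v = d"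
    using G by (auto simp: regular_graphs_def simple_graph_def)
  have fin: "finite (edges G)" using E by (rule finite_subset) (simp add: finite_imp_finite_nsets)
  have cE: "card (edges G) = M" using card_edges_regular_graph[OF G] M by simp
  let ?A = "{w \<in> simple_words N M d. word_graph N M w = G}"
  let ?L = "labellings M (edges G)"
  have A: "?A = {w \<in> positions M \<rightarrow>\<^sub>E {..<N}. restrict (pair_edge w) {..<M} \<in> ?L}"
  proof (intro subset_antisym subsetI)
    fix w assume w: "w \<in> ?A"
    then have "pair_edge w ` {..<M} = edges G" "inj_on (pair_edge w) {..<M}" "w \<in> positions M \<rightarrow>\<^sub>E {..<N}"
      using bad_pairs_empty_iff by (auto simp: word_graph_def simple_words_def words_def)
    then show "w \<in> {w \<in> positions M \<rightarrow>\<^sub>E {..<N}. restrict (pair_edge w) {..<M} \<in> ?L}"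
      by (auto simp: labellings_def bij_betw_def)
  next
    fix w assume "w \<in> {w \<in> positions M \<rightarrow>\<^sub>E {..<N}. restrict (pair_edge w) {..<M} \<in> ?L}"
    then have w: "w \<in> positions M \<rightarrow>\<^sub>E {..<N}" and bij: "bij_betw (pair_edge w) {..<M} (edges G)"
      unfolding labellings_def mem_Collect_eq bij_betw_restrict_eq by blast+
    have inj: "inj_on (pair_edge w) {..<M}" and img: "pair_edge w ` {..<M} = edges G"
      using bij by (auto simp: bij_betw_def)
    have wG: "word_graph N M w = G" using img V by (simp add: word_graph_def prod_eq_iff)
    have "w (i, False) \<noteq> w (i, True)" if "i < M" for i
    proof
      assume "w (i, False) = w (i, True)"
      then have "card (pair_edge w i) = 1" by (simp add: pair_edge_def)
      moreover have "pair_edge w i \<in> [{..<N}]\<^bsup>2\<^esup>" using img E that by auto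
      ultimately show False by (simp add: nsets_def)
    qed
    then have loopfree: "\<forall>i<M. w (i, False) \<noteq> w (i, True)" by blast
    have "card {p \<in> positions M. w p = v} = d" if "v < N" for v
      using card_letter_eq_degree[OF loopfree inj, of v N] wG deg[OF that] by simp
    then show "w \<in> ?A" using w wG loopfree inj bad_pairs_empty_iff
      by (auto simp: simple_words_def words_def)
  qed
  have "card ?A = (\<Sum>f\<in>?L. card {w \<in> ?A. restrict (pair_edge w) {..<M} = f})"
  proof (rule card_eq_sum_fibres)
    show "finite ?A" by simp
    show "finite ?L" by (rule finite_labellings[OF fin])
    show "(\<lambda>w. restrict (pair_edge w) {..<M}) ` ?A \<subseteq> ?L" using A by blast
  qed
  also have "\<dots> = (\<Sum>f\<in>?L. 2 ^ M)"
  proof (rule sum.cong[OF refl])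
    fix f assume f: "f \<in> ?L"
    then have "{w \<in> ?A. restrict (pair_edge w) {..<M} = f} =
        {w \<in> positions M \<rightarrow>\<^sub>E {..<N}. restrict (pair_edge w) {..<M} = f}"
      unfolding A by blast
    moreover have "f \<in> {..<M} \<rightarrow>\<^sub>E [{..<N}]\<^bsup>2\<^esup>" using f E by (auto simp: labellings_def PiE_def Pi_def)
    ultimately show "card {w \<in> ?A. restrict (pair_edge w) {..<M} = f} = 2 ^ M"
      using card_orientations by simp
  qed
  also have "\<dots> = card (labellings M {..<M}) * 2 ^ M" by (simp add: card_labellings[OF fin cE])
  finally show ?thesis .
qed

lemma card_regular_graphs_words:
  assumes M: "2 * M = d * N" and A: "A \<subseteq> regular_graphs N d"
  shows "card {w \<in> simple_words N M d. word_graph N M w \<in> A} = card A * (card (labellings M {..<M}) * 2 ^ M)"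
proof -
  let ?X = "{w \<in> simple_words N M d. word_graph N M w \<in> A}"
  have fin: "finite A" using A finite_regular_graphs by (rule finite_subset)
  have "card ?X = (\<Sum>G\<in>A. card {w \<in> ?X. word_graph N M w = G})"
    by (rule card_eq_sum_fibres) (use fin in auto)
  also have "\<dots> = (\<Sum>G\<in>A. card (labellings M {..<M}) * 2 ^ M)"
  proof (rule sum.cong[OF refl])
    fix G assume G: "G \<in> A"
    then have "{w \<in> ?X. word_graph N M w = G} = {w \<in> simple_words N M d. word_graph N M w = G}" by blast
    moreover have "G \<in> regular_graphs N d" using G A by blast
    ultimately show "card {w \<in> ?X. word_graph N M w = G} = card (labellings M {..<M}) * 2 ^ M"
      using card_word_graph_fibre[OF _ M] by (simp only:)
  qed
  finally show ?thesis by simp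
qed

section \<open>Union bound over all pairs of sets\<close>

lemma avoids_pattern_if_separated:
  assumes "separated (word_graph N M w) S T"
  shows "case_prod (avoids M) (pattern M S T w)"
proof -
  have "w (i, \<not> b) \<notin> T" if "i < M" "w (i, b) \<in> S" for i b
  proof
    assume "w (i, \<not> b) \<in> T"
    then have "{w (i, b), w (i, \<not> b)} \<notin> edges (word_graph N M w)"
      using assms that(2) by (simp add: separated_def)
    moreover have "{w (i, b), w (i, \<not> b)} = pair_edge w i" by (cases b) (auto simp: pair_edge_def)
    ultimately show False using that(1) by (auto simp: word_graph_def)
  qed
  then show ?thesis by (auto simp: avoids_def pattern_def)
qed

text \<open>For one pair \<open>(S, T)\<close> the proportion of avoiding words is that of avoiding
  patterns. Summing over the pairs and passing to simple words, at the polynomial cost, bounds the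
  proportion of graphs, with denominators multiplied out.\<close>

lemma card_separated_regular_graphs:
  assumes M: "2 * M = d * N" and K: "K = 2 * (d + 2 * d * d)" "M > K + d * (2 * d + 2) + 5"
  shows "card {G \<in> regular_graphs N d. \<exists>(S, T) \<in> disjoint_pairs {..<N} k. separated G S T} *
      card (disjoint_pairs (positions M) (d * k)) \<le>
    2 * (4 * M\<^sup>2 + 1) ^ K * card (disjoint_pairs {..<N} k) *
      card {x \<in> disjoint_pairs (positions M) (d * k). case_prod (avoids M) x} * card (regular_graphs N d)"
proof -
  let ?Bad = "{G \<in> regular_graphs N d. \<exists>(S, T) \<in> disjoint_pairs {..<N} k. separated G S T}"
  let ?C = "card (labellings M {..<M}) * 2 ^ M"
  let ?D = "disjoint_pairs {..<N} k" and ?D' = "card (disjoint_pairs (positions M) (d * k))"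
  let ?a = "card {x \<in> disjoint_pairs (positions M) (d * k). case_prod (avoids M) x}"
  let ?F = "\<lambda>x. {w \<in> words N M d. case_prod (avoids M) (pattern M (fst x) (snd x) w)}"
  have "card (labellings M {..<M}) > 0"
    using labellings_nonempty[of M] finite_labellings[of "{..<M}" M] by (auto simp: card_gt_0_iff)
  then have C: "?C > 0" by simp
  have "simple_words N M d = {w \<in> simple_words N M d. word_graph N M w \<in> regular_graphs N d}"
    using word_graph_regular by blast
  then have RG: "card (simple_words N M d) = card (regular_graphs N d) * ?C"
    using card_regular_graphs_words[OF M order.refl] by simp
  have finD: "finite ?D" by (simp add: finite_disjoint_pairs)
  have "{w \<in> simple_words N M d. word_graph N M w \<in> ?Bad} \<subseteq> (\<Union>x\<in>?D. ?F x)"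
  proof
    fix w assume w: "w \<in> {w \<in> simple_words N M d. word_graph N M w \<in> ?Bad}"
    then obtain S T where ST: "(S, T) \<in> ?D" "separated (word_graph N M w) S T" by blast
    have "w \<in> words N M d" using w unfolding simple_words_def by blast
    then have "w \<in> ?F (S, T)" using avoids_pattern_if_separated[OF ST(2)] by (simp only: mem_Collect_eq fst_conv snd_conv simp_thms)
    then show "w \<in> (\<Union>x\<in>?D. ?F x)" by (rule UN_I[OF ST(1)])
  qed
  then have "card ?Bad * ?C \<le> card (\<Union>x\<in>?D. ?F x)"
    using card_mono[of "\<Union>x\<in>?D. ?F x" "{w \<in> simple_words N M d. word_graph N M w \<in> ?Bad}"] finD
      card_regular_graphs_words[OF M, of ?Bad] by simp
  also have "\<dots> \<le> (\<Sum>x\<in>?D. card (?F x))" by (rule card_UN_le[OF finD])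
  finally have "card ?Bad * ?C * ?D' \<le> (\<Sum>x\<in>?D. card (?F x) * ?D')"
    by (simp add: mult_right_mono flip: sum_distrib_right)
  also have "\<dots> = (\<Sum>x\<in>?D. ?a * card (words N M d))"
    by (rule sum.cong[OF refl]) (use card_words_avoids in force)
  also have "\<dots> = card ?D * ?a * card (words N M d)" by simp
  also have "\<dots> \<le> card ?D * ?a * (2 * (4 * M\<^sup>2 + 1) ^ K * card (simple_words N M d))"
    using card_words_le_simple[OF K, of N] by (intro mult_left_mono) (auto simp: simple_words_def)
  also have "\<dots> = (2 * (4 * M\<^sup>2 + 1) ^ K * card ?D * ?a * card (regular_graphs N d)) * ?C"
    unfolding RG by (simp only: ac_simps)
  finally have "(card ?Bad * ?D') * ?C \<le> (2 * (4 * M\<^sup>2 + 1) ^ K * card ?D * ?a * card (regular_graphs N d)) * ?C"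
    by (simp only: ac_simps)
  then show ?thesis using C by (simp only: mult_le_cancel2)
qed

text \<open>Each vertex is split into \<open>d\<close> points; a bijection from positions to points,
  followed by the projection to vertices, is a word.\<close>

lemma words_nonempty:
  assumes "2 * M = d * N"
  shows "words N M d \<noteq> {}"
proof -
  have "card (positions M) = card ({..<N} \<times> {..<d})" using assms by (simp add: card_cartesian_product)
  then obtain h where h: "bij_betw h (positions M) ({..<N} \<times> {..<d})"
    using finite_same_card_bij[of "positions M" "{..<N} \<times> {..<d}"] by auto
  let ?w = "restrict (fst \<circ> h) (positions M)"
  have "card {p \<in> positions M. ?w p = v} = d" if "v < N" for v
  proof -
    have "inj_on h {p \<in> positions M. fst (h p) = v}"
      using h by (auto simp: bij_betw_def inj_on_def)
    moreover have "h ` {p \<in> positions M. fst (h p) = v} = {v} \<times> {..<d}"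
    proof (intro subset_antisym subsetI)
      fix q assume q: "q \<in> {v} \<times> {..<d}"
      then have "q \<in> h ` positions M" using h that by (auto simp: bij_betw_def)
      then obtain p where "q = h p" "p \<in> positions M" by (rule imageE)
      then show "q \<in> h ` {p \<in> positions M. fst (h p) = v}" using q by auto
    next
      fix q assume q: "q \<in> h ` {p \<in> positions M. fst (h p) = v}"
      then have "q \<in> {..<N} \<times> {..<d}" "fst q = v" using h by (auto simp: bij_betw_def)
      then show "q \<in> {v} \<times> {..<d}" by (cases q) simp
    qed
    ultimately have "card {p \<in> positions M. fst (h p) = v} = card ({v} \<times> {..<d})"
      using card_image[of h "{p \<in> positions M. fst (h p) = v}"] by simp
    moreover have "{p \<in> positions M. ?w p = v} = {p \<in> positions M. fst (h p) = v}" by auto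
    ultimately show ?thesis by (simp add: card_cartesian_product)
  qed
  moreover have "?w \<in> positions M \<rightarrow>\<^sub>E {..<N}"
  proof (rule restrict_PiE_iff[THEN iffD2], rule ballI)
    fix p assume "p \<in> positions M"
    then have "h p \<in> {..<N} \<times> {..<d}" using h by (auto simp: bij_betw_def)
    then show "(fst \<circ> h) p \<in> {..<N}" by (cases "h p") simp
  qed
  ultimately have "?w \<in> words N M d" by (simp add: words_def)
  then show ?thesis by blast
qed

lemma regular_graphs_nonempty:
  assumes "2 * M = d * N" "K = 2 * (d + 2 * d * d)" "M > K + d * (2 * d + 2) + 5"
  shows "regular_graphs N d \<noteq> {}"
proof -
  have "card (words N M d) > 0" using words_nonempty[OF assms(1)] by (simp add: card_gt_0_iff)
  moreover have "card (words N M d) \<le> 2 * (4 * M\<^sup>2 + 1) ^ K * card (simple_words N M d)"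
    using card_words_le_simple[OF assms(2,3), of N] by (simp only: simple_words_def)
  ultimately have "card (simple_words N M d) > 0" by (cases "card (simple_words N M d) = 0") auto
  then obtain w where "w \<in> simple_words N M d" by (auto simp: card_gt_0_iff)
  then show ?thesis using word_graph_regular by blast
qed

section \<open>Entropy estimates\<close>

lemma ln_fact_Suc: "ln (fact (Suc n) :: real) = ln (real (Suc n)) + ln (fact n)"
  by (simp only: fact_Suc of_nat_mult of_nat_fact) (simp add: ln_mult del: of_nat_Suc)

text \<open>With \<open>ln_fact_le\<close> this is a crude Stirling formula, whose gap ln n + 1
  yields only polynomial factors. The induction step is ln (1 + 1/n) \<le> 1/n.\<close>

lemma ln_fact_ge: "real n * ln (real n) - real n \<le> ln (fact n)"
proof (induction n)
  case (Suc n)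
  define L where "L = ln (real (Suc n))"
  have "real n * (L - ln (real n)) \<le> 1"
  proof (cases "n = 0")
    case False
    then have "ln (real (Suc n) / real n) \<le> real (Suc n) / real n - 1" by (intro ln_le_minus_one) simp
    then have "L - ln (real n) \<le> 1 / real n" using False by (simp add: ln_div L_def field_simps)
    then show ?thesis using False by (simp add: field_simps)
  qed simp
  then have "real (Suc n) * L - real (Suc n) \<le> ln (fact (Suc n))"
    using Suc unfolding ln_fact_Suc L_def[symmetric] by (simp add: algebra_simps)
  then show ?case by (simp only: L_def)
qed simp

lemma ln_fact_le: "n \<ge> 1 \<Longrightarrow> ln (fact n) \<le> real n * ln (real n) - real n + ln (real n) + 1"
proof (induction n rule: nat_induct_at_least)
  case (Suc n)
  define L where "L = ln (real (Suc n))"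
  have "ln (real n / real (Suc n)) \<le> real n / real (Suc n) - 1" using Suc(1) by (intro ln_le_minus_one) simp
  then have "ln (real n) - L \<le> - 1 / real (Suc n)"
    using Suc(1) by (simp add: ln_div L_def field_simps)
  then have "1 \<le> real (Suc n) * (L - ln (real n))" by (simp add: field_simps)
  then have "ln (fact (Suc n)) \<le> real (Suc n) * L - real (Suc n) + L + 1"
    using Suc unfolding ln_fact_Suc L_def[symmetric] by (simp add: algebra_simps)
  then show ?case by (simp only: L_def)
qed simp

text \<open>This is \<open>m H\<close>, where \<open>H\<close> is the entropy of the distribution \<open>(k/m, k/m, 1 - 2k/m)\<close>.\<close>

definition pair_entropy :: "nat \<Rightarrow> nat \<Rightarrow> real" where
  "pair_entropy m k = real m * ln (real m) - 2 * (real k * ln (real k)) - real (m - 2 * k) * ln (real (m - 2 * k))"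

lemma ln_card_disjoint_pairs:
  assumes "finite X" "2 * k \<le> card X"
  shows "ln (real (card (disjoint_pairs X k))) =
      ln (fact (card X)) - 2 * ln (fact k) - ln (fact (card X - 2 * k))"
proof -
  let ?m = "card X"
  have "real (card (disjoint_pairs X k)) = real (?m choose k) * real ((?m - k) choose k)"
    using assms(1) by (simp add: card_disjoint_pairs)
  also have "\<dots> = fact ?m / (fact k * fact (?m - k)) * (fact (?m - k) / (fact k * fact (?m - k - k)))"
    using assms(2) by (simp add: binomial_fact)
  also have "?m - k - k = ?m - 2 * k" by simp
  finally have "real (card (disjoint_pairs X k)) = fact ?m / (fact k * fact k * fact (?m - 2 * k))" by simp
  then show ?thesis by (simp add: ln_div ln_mult)
qed

lemma ln_card_disjoint_pairs_le:
  assumes "finite X" "2 * k \<le> card X" "card X \<ge> 1"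
  shows "ln (real (card (disjoint_pairs X k))) \<le> pair_entropy (card X) k + ln (real (card X)) + 1"
proof -
  have "real (card X) = 2 * real k + real (card X - 2 * k)" using assms(2) by (simp add: of_nat_diff)
  then show ?thesis
    using ln_card_disjoint_pairs[OF assms(1,2)] ln_fact_le[OF assms(3)] ln_fact_ge[of k] ln_fact_ge[of "card X - 2 * k"]
    unfolding pair_entropy_def by linarith
qed

text \<open>Each of the three factorials in the denominator costs \<open>ln (card X) + 1\<close>.
  Strictness of \<open>2 * k < card X\<close> keeps the last one within the range of
  \<open>ln_fact_le\<close>.\<close>

lemma ln_card_disjoint_pairs_ge:
  assumes "finite X" "2 * k < card X" "k \<ge> 1"
  shows "pair_entropy (card X) k - 3 * ln (real (card X)) - 3 \<le> ln (real (card (disjoint_pairs X k)))"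
proof -
  have "ln (real k) \<le> ln (real (card X))" "ln (real (card X - 2 * k)) \<le> ln (real (card X))"
    using assms by auto
  moreover have "real (card X) = 2 * real k + real (card X - 2 * k)" using assms(2) by (simp add: of_nat_diff)
  moreover have "card X - 2 * k \<ge> 1" "2 * k \<le> card X" using assms(2) by simp_all
  ultimately show ?thesis
    using ln_card_disjoint_pairs[of X k] ln_fact_ge[of "card X"] ln_fact_le[OF assms(3)] ln_fact_le[of "card X - 2 * k"] assms(1)
    unfolding pair_entropy_def by linarith
qed

text \<open>The entropy is homogeneous of degree one: the \<open>ln d\<close> terms cancel because
  \<open>m = 2 * k + (m - 2 * k)\<close>. Patterns thus have \<open>d\<close> times the entropy of
  pairs of vertex sets, whence the factor \<open>1 - d\<close> in the exponent.\<close>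

lemma pair_entropy_mult:
  assumes "d \<ge> 1" "2 * k < m" "k \<ge> 1"
  shows "pair_entropy (d * m) (d * k) = real d * pair_entropy m k"
proof -
  define r where "r = m - 2 * k"
  have r: "d * m - 2 * (d * k) = d * r" "r > 0" "real m = 2 * real k + real r"
    using assms by (simp_all add: r_def algebra_simps of_nat_diff)
  have xlnx: "real (d * j) * ln (real (d * j)) = real d * real j * ln (real d) + real d * (real j * ln (real j))"
    if "j > 0" for j
    using that assms(1) by (simp add: ln_mult algebra_simps)
  have "m > 0" "k > 0" using assms by simp_all
  moreover have "real d * real m * ln (real d) = 2 * (real d * real k * ln (real d)) + real d * real r * ln (real d)"
    unfolding r(3) by (simp add: algebra_simps)
  ultimately show ?thesis
    unfolding pair_entropy_def r(1) r_def[symmetric] using r(2) by (simp only: xlnx right_diff_distrib) simp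
qed

lemma pair_entropy_eq:
  assumes "k \<ge> 1" "2 * k < m" "q = real k / real m"
  shows "pair_entropy m k = real m * (- 2 * q * ln q - (1 - 2 * q) * ln (1 - 2 * q))"
proof -
  have m: "real m > 0" using assms by simp
  have q1: "real (m - 2 * k) = real m * (1 - 2 * q)" and q2: "real k = real m * q"
    using assms by (auto simp: of_nat_diff field_simps)
  have "q > 0" using assms(1,3) m by simp
  moreover have "1 - 2 * q > 0" using q1 m assms(2) by (metis of_nat_0_less_iff zero_less_diff zero_less_mult_pos)
  ultimately have "ln (real m * q) = ln (real m) + ln q" "ln (real m * (1 - 2 * q)) = ln (real m) + ln (1 - 2 * q)"
    using m by (simp_all add: ln_mult)
  then show ?thesis
    unfolding pair_entropy_def q1 q2 by (simp only:) (simp add: algebra_simps)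
qed

text \<open>The bound \<open>ln y \<le> ln z + y / z - 1\<close> with \<open>z\<close> a ratio of powers of 2, 3, 5, 13 close to \<open>y\<close>
  loses only a second-order term; the margin is about \<open>9 * 10\<^sup>-\<^sup>5\<close>.\<close>

lemma ln_le_tangent: "0 < y \<Longrightarrow> 0 < z \<Longrightarrow> ln y \<le> ln z + (y / z - 1)" for y z :: real
  using ln_le_minus_one[of "y / z"] by (simp add: ln_div)

text \<open>\<open>a\<close> is the limit (c - 2) / (4 c) of k / N for c = 5.219. \<open>x\<close>
  is \<open>(13 / 25)^2\<close>: it nearly satisfies x (1 + x) = a (1 + 4 x + 2 x^2), the condition
  for a stationary point, and its logarithm needs only \<open>ln 5\<close> and
  \<open>ln 13\<close>.\<close>

lemma exponent_negative:
  fixes a x :: real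
  defines "a \<equiv> 3219 / 20876" and "x \<equiv> 169 / 625"
  shows "15 * ln (1 + 4 * x + 2 * x\<^sup>2) - 60 * a * ln x
    - 29 * (- 2 * a * ln a - (1 - 2 * a) * ln (1 - 2 * a)) < 0"
proof -
  have L2: "ln (2::real) \<in> {0.69314717..0.69314719}"
    using ln_approx_bounds[of 2 8, simplified] by (auto simp: eval_nat_numeral)
  have L32: "ln (3/2::real) \<in> {0.40546510..0.40546511}"
    using ln_approx_bounds[of "3/2" 6, simplified] by (auto simp: eval_nat_numeral)
  have L54: "ln (5/4::real) \<in> {0.22314355..0.22314356}"
    using ln_approx_bounds[of "5/4" 5, simplified] by (auto simp: eval_nat_numeral)
  have L1312: "ln (13/12::real) \<in> {0.08004270..0.08004271}"
    using ln_approx_bounds[of "13/12" 4, simplified] by (auto simp: eval_nat_numeral)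
  have l3: "ln (3::real) = ln 2 + ln (3/2)" by (simp add: ln_div)
  have l4: "ln (4::real) = 2 * ln 2" using ln_mult[of 2 2] by simp
  have l5: "ln (5::real) = 2 * ln 2 + ln (5/4)" using l4 by (simp add: ln_div)
  have l12: "ln (12::real) = 2 * ln 2 + ln 3" using ln_mult[of 4 3] l4 by simp
  have l13: "ln (13::real) = 2 * ln 2 + ln 3 + ln (13/12)" using l12 by (simp add: ln_div)
  have x: "ln x = 2 * ln 13 - 4 * ln 5"
  proof -
    have "x = 13^2 / 5^4" by (simp add: x_def)
    also have "ln \<dots> = ln (13^2) - ln (5^4)" by (subst ln_div) simp_all
    also have "\<dots> = 2 * ln 13 - 4 * ln 5" by (simp only: ln_realpow zero_less_numeral)
    finally show ?thesis .
  qed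
  have l3125: "ln (3125::real) = 5 * ln 5" using ln_realpow[of 5 5] by simp
  have l27: "ln (27::real) = 3 * ln 3" using ln_realpow[of 3 3] by simp
  have l1404: "ln (1404::real) = 2 * ln 2 + 3 * ln 3 + ln 13"
    using ln_mult[of 4 "27 * 13"] ln_mult[of 27 13] l4 l27 by simp
  \<comment> \<open>\<open>3125 / 1404 = 5^5 / (2^2 * 3^3 * 13)\<close>.\<close>
  have A: "ln (1 + 4 * x + 2 * x\<^sup>2) \<le> 5 * ln 5 - 2 * ln 2 - 3 * ln 3 - ln 13 + ((1 + 4 * x + 2 * x\<^sup>2) / (3125 / 1404) - 1)"
    using ln_le_tangent[of "1 + 4 * x + 2 * x\<^sup>2" "3125 / 1404"] l3125 l1404
    by (simp add: x_def ln_div power2_eq_square)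
  have B: "ln a \<le> ln 2 - ln 13 + (a * 13 / 2 - 1)"
    using ln_le_tangent[of a "2/13"] by (simp add: a_def ln_div)
  have l9: "ln (9::real) = 2 * ln 3" using ln_mult[of 3 3] by simp
  have C: "ln (1 - 2 * a) \<le> 2 * ln 3 - ln 13 + ((1 - 2 * a) * 13 / 9 - 1)"
    using ln_le_tangent[of "1 - 2 * a" "9/13"] l9 by (simp add: a_def ln_div)
  \<comment> \<open>Subtracting the entropy gives positive coefficients to \<open>ln a\<close> and
    \<open>ln (1 - 2 * a)\<close>, so upper bounds for all three logarithms suffice;
    \<open>ln x\<close> is exact.\<close>
  have "15 * ln (1 + 4 * x + 2 * x\<^sup>2) - 60 * a * ln x - 29 * (- 2 * a * ln a - (1 - 2 * a) * ln (1 - 2 * a)) =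
      15 * ln (1 + 4 * x + 2 * x\<^sup>2) - 60 * a * (2 * ln 13 - 4 * ln 5) + 58 * a * ln a + 29 * (1 - 2 * a) * ln (1 - 2 * a)"
    unfolding x by (simp add: algebra_simps)
  also have "\<dots> \<le> 15 * (5 * ln 5 - 2 * ln 2 - 3 * ln 3 - ln 13 + ((1 + 4 * x + 2 * x\<^sup>2) / (3125 / 1404) - 1))
      - 60 * a * (2 * ln 13 - 4 * ln 5) + 58 * a * (ln 2 - ln 13 + (a * 13 / 2 - 1))
      + 29 * (1 - 2 * a) * (2 * ln 3 - ln 13 + ((1 - 2 * a) * 13 / 9 - 1))"
    by (intro add_mono diff_mono mult_left_mono A B C order.refl) (simp_all add: a_def)
  also have "\<dots> < 0"
    using L2 L32 L54 L1312 unfolding l13 l5 l3 a_def x_def atLeastAtMost_iff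
    by (simp add: power2_eq_square field_simps)
  finally show ?thesis .
qed

section \<open>The first moment bound\<close>

text \<open>The exponent collects the loss for simplicity, the Stirling errors for vertex sets and
  for patterns (with \<open>4 = 1 + 3\<close>), the entropies, and the saddle-point bound.\<close>

lemma card_separated_le_exp:
  fixes x :: real
  assumes M: "2 * M = d * N" and K: "K = 2 * (d + 2 * d * d)" "M > K + d * (2 * d + 2) + 5"
    and k: "k \<ge> 1" "2 * k < N" and d: "d \<ge> 1" and x: "x > 0"
  shows "real (card {G \<in> regular_graphs N d. \<exists>(S, T) \<in> disjoint_pairs {..<N} k. separated G S T}) \<le>
    exp (ln 2 + real K * ln (real (4 * M\<^sup>2 + 1)) + ln (real N) + 3 * ln (real (d * N)) + 4
      + (1 - real d) * pair_entropy N k + real M * ln (1 + 4 * x + 2 * x\<^sup>2) - 2 * real (d * k) * ln x) *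
    real (card (regular_graphs N d))"
proof -
  let ?bad = "real (card {G \<in> regular_graphs N d. \<exists>(S, T) \<in> disjoint_pairs {..<N} k. separated G S T})"
  let ?RG = "real (card (regular_graphs N d))"
  define D where "D = real (card (disjoint_pairs {..<N} k))"
  define D' where "D' = real (card (disjoint_pairs (positions M) (d * k)))"
  define a where "a = real (card {y \<in> disjoint_pairs (positions M) (d * k). case_prod (avoids M) y})"
  define A where "A = 1 + 4 * x + 2 * x\<^sup>2"
  have A: "A > 0" using x by (simp add: A_def add_pos_pos)
  have dk: "2 * (d * k) < card (positions M)" "d * k \<ge> 1"
    using k d by (simp_all add: M)
  have "real (binomial n j) > 0" if "j \<le> n" for n j using that by simp
  then have pos: "D > 0" "D' > 0"
    unfolding D_def D'_def using k dk by (simp_all add: card_disjoint_pairs)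
  have "ln D \<le> pair_entropy N k + ln (real N) + 1"
    unfolding D_def using ln_card_disjoint_pairs_le[of "{..<N}" k] k by simp
  then have D: "D \<le> exp (pair_entropy N k + ln (real N) + 1)"
    using pos(1) by (metis exp_le_cancel_iff exp_ln)
  have "pair_entropy (d * N) (d * k) - 3 * ln (real (d * N)) - 3 \<le> ln D'"
    unfolding D'_def using ln_card_disjoint_pairs_ge[OF _ dk] by (simp add: M)
  then have D': "exp (real d * pair_entropy N k - 3 * ln (real (d * N)) - 3) \<le> D'"
    using pair_entropy_mult[OF d k(2,1)] pos(2) by (simp add: ln_ge_iff)
  have "a * x ^ (2 * (d * k)) \<le> A ^ M"
    unfolding a_def A_def by (rule card_avoiding_pairs_le) (use x in simp)
  moreover have "A ^ M = exp (real M * ln A)" using A by (simp add: exp_of_nat_mult)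
  moreover have "x ^ (2 * (d * k)) = exp (real (2 * (d * k)) * ln x)" using x by (simp only: exp_of_nat_mult exp_ln)
  ultimately have a: "a \<le> exp (real M * ln A - 2 * real (d * k) * ln x)"
    by (simp add: exp_diff field_simps)
  define C where "C = exp (ln 2 + real K * ln (real (4 * M\<^sup>2 + 1)))"
  have "real (4 * M\<^sup>2 + 1) > 0" by (simp only: of_nat_0_less_iff)
  then have C: "C = real (2 * (4 * M\<^sup>2 + 1) ^ K)"
    unfolding C_def by (simp only: exp_add exp_of_nat_mult exp_ln of_nat_mult of_nat_power of_nat_numeral)
  have "?bad * D' \<le> C * D * a * ?RG"
    unfolding C D_def D'_def a_def of_nat_mult[symmetric] of_nat_le_iff by (rule card_separated_regular_graphs[OF M K])
  also have "\<dots> \<le> C * exp (pair_entropy N k + ln (real N) + 1) * exp (real M * ln A - 2 * real (d * k) * ln x) * ?RG"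
    using D a pos by (intro mult_right_mono mult_mono) (auto simp: C_def a_def)
  \<comment> \<open>The lower bound for \<open>D'\<close> is split off so that \<open>D'\<close> can
    be cancelled.\<close>
  also have "\<dots> = exp (ln 2 + real K * ln (real (4 * M\<^sup>2 + 1)) + ln (real N) + 3 * ln (real (d * N)) + 4
      + (1 - real d) * pair_entropy N k + real M * ln A - 2 * real (d * k) * ln x) * ?RG *
      exp (real d * pair_entropy N k - 3 * ln (real (d * N)) - 3)"
    (is "_ = exp ?E * ?RG * _")
    unfolding C_def mult_exp_exp mult.assoc[of _ ?RG] mult.commute[of ?RG] by (simp add: algebra_simps flip: exp_add)
  also have "\<dots> \<le> exp ?E * ?RG * D'" by (intro mult_left_mono D') auto
  finally show ?thesis using pos(2) by (simp add: A_def)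
qed

lemma regular_graphs_arrows_error:
  fixes N n d M K :: nat and x :: real
  assumes M: "2 * M = d * N" and K: "K = 2 * (d + 2 * d * d)" "M > K + d * (2 * d + 2) + 5"
    and k: "k = (N - 2 * n) div 4" "k \<ge> 1" and d: "d \<ge> 1" and x: "x > 0"
  shows "measure_pmf.prob (random_regular_graph N d) {G. arrows G (path_graph n)} \<ge>
    1 - exp (ln 2 + real K * ln (real (4 * M\<^sup>2 + 1)) + ln (real N) + 3 * ln (real (d * N)) + 4
      + (1 - real d) * pair_entropy N k + real M * ln (1 + 4 * x + 2 * x\<^sup>2) - 2 * real (d * k) * ln x)"
    (is "_ \<ge> 1 - exp ?E")
proof -
  let ?R = "regular_graphs N d"
  let ?Bad = "{G \<in> ?R. \<exists>(S, T) \<in> disjoint_pairs {..<N} k. separated G S T}"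
  have fin: "finite ?R" by (rule finite_regular_graphs)
  have ne: "?R \<noteq> {}" by (rule regular_graphs_nonempty[OF M K])
  then have pos: "real (card ?R) > 0" using fin by (simp add: card_gt_0_iff)
  have "?R - ?Bad \<subseteq> ?R \<inter> {G. arrows G (path_graph n)}"
  proof
    fix G assume G: "G \<in> ?R - ?Bad"
    then have V: "verts G = {..<N}" by (simp add: regular_graphs_def)
    have "arrows G (path_graph n)"
    proof (rule arrows_path_graph_if_no_separated)
      fix S T assume "(S, T) \<in> disjoint_pairs (verts G) ((card (verts G) - 2 * n) div 4)"
      then have "(S, T) \<in> disjoint_pairs {..<N} k" by (simp add: V k(1))
      then show "\<not> separated G S T" using G by blast
    qed (simp add: V)
    then show "G \<in> ?R \<inter> {G. arrows G (path_graph n)}" using G by blast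
  qed
  then have "card (?R - ?Bad) \<le> card (?R \<inter> {G. arrows G (path_graph n)})"
    using fin by (intro card_mono) auto
  moreover have "real (card (?R - ?Bad)) = real (card ?R) - real (card ?Bad)"
    using fin by (subst card_Diff_subset) (auto intro: of_nat_diff card_mono)
  moreover have "real (card ?Bad) \<le> exp ?E * real (card ?R)"
    by (rule card_separated_le_exp[OF M K k(2) _ d x]) (use k in linarith)
  ultimately have "(1 - exp ?E) * real (card ?R) \<le> real (card (?R \<inter> {G. arrows G (path_graph n)}))"
    by (simp add: algebra_simps)
  then show ?thesis
    using pos unfolding random_regular_graph_def measure_pmf_of_set[OF ne fin] by (simp add: field_simps)
qed

section \<open>The case of degree 30 and its limit\<close>

text \<open>The exponent per vertex at q = k / N, where \<open>15\<close>, \<open>60\<close> and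
  \<open>29\<close> are d / 2, 2 d and d - 1 for d = 30.\<close>

definition exponent_rate :: "real \<Rightarrow> real" where
  "exponent_rate q = 15 * ln (1 + 4 * (169 / 625) + 2 * (169 / 625)\<^sup>2) - 60 * q * ln (169 / 625)
    - 29 * (- 2 * q * ln q - (1 - 2 * q) * ln (1 - 2 * q))"

lemma tendsto_exponent_rate:
  assumes "(q \<longlongrightarrow> 3219 / 20876) F"
  shows "((\<lambda>n. exponent_rate (q n)) \<longlongrightarrow> exponent_rate (3219 / 20876)) F"
  unfolding exponent_rate_def by (intro tendsto_intros assms) simp_all

text \<open>\<open>3660\<close> is the \<open>K\<close> for d = 30,
  \<open>901 = 4 * 15^2 + 1\<close>, and \<open>7324 = 2 * 3660 + 1 + 3\<close> collects the
  coefficients of \<open>ln N\<close>. \<open>N > 400\<close> makes \<open>15 * N\<close> exceed the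
  required \<open>5525\<close>.\<close>

lemma arrows_probability_ge:
  fixes N n :: nat
  assumes N: "N > 400" and k: "k = (N - 2 * n) div 4" "k \<ge> 1"
  shows "measure_pmf.prob (random_regular_graph N 30) {G. arrows G (path_graph n)} \<ge>
    1 - exp (((ln 2 + 3660 * ln 901 + 3 * ln 30 + 4 + 7324 * ln (real N)) / real N
      + exponent_rate (real k / real N)) * real N)"
proof -
  let ?x = "169 / 625 :: real"
  let ?E = "ln 2 + real 3660 * ln (real (4 * (15 * N)\<^sup>2 + 1)) + ln (real N) + 3 * ln (real (30 * N)) + 4
      + (1 - real 30) * pair_entropy N k + real (15 * N) * ln (1 + 4 * ?x + 2 * ?x\<^sup>2) - 2 * real (30 * k) * ln ?x"
  have N0: "real N > 0" using N by simp
  have "measure_pmf.prob (random_regular_graph N 30) {G. arrows G (path_graph n)} \<ge> 1 - exp ?E"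
    by (rule regular_graphs_arrows_error[OF _ _ _ k]) (use N in auto)
  moreover have "?E \<le> ((ln 2 + 3660 * ln 901 + 3 * ln 30 + 4 + 7324 * ln (real N)) / real N
      + exponent_rate (real k / real N)) * real N"
  proof -
    have "real (4 * (15 * N)\<^sup>2 + 1) \<le> 901 * (real N)\<^sup>2"
      using N by (simp add: power_mult_distrib)
    then have "ln (real (4 * (15 * N)\<^sup>2 + 1)) \<le> ln (901 * (real N)\<^sup>2)"
      by (subst ln_le_cancel_iff) (use N in \<open>auto simp: add_pos_nonneg\<close>)
    also have "\<dots> = ln 901 + 2 * ln (real N)" using N0 by (simp add: ln_mult ln_realpow)
    finally have 1: "ln (real (4 * (15 * N)\<^sup>2 + 1)) \<le> ln 901 + 2 * ln (real N)" .
    have 2: "ln (real (30 * N)) = ln 30 + ln (real N)" using N0 by (simp add: ln_mult)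
    have 3: "pair_entropy N k = real N * (- 2 * (real k / real N) * ln (real k / real N)
        - (1 - 2 * (real k / real N)) * ln (1 - 2 * (real k / real N)))"
      by (rule pair_entropy_eq) (use k in auto)
    have 4: "((ln 2 + 3660 * ln 901 + 3 * ln 30 + 4 + 7324 * ln (real N)) / real N
      + exponent_rate (real k / real N)) * real N =
      ln 2 + 3660 * ln 901 + 3 * ln 30 + 4 + 7324 * ln (real N) + real N * (15 * ln (1 + 4 * ?x + 2 * ?x\<^sup>2))
        - 60 * real k * ln ?x - 29 * pair_entropy N k"
      unfolding 3 exponent_rate_def using N0 by (simp add: field_simps)
    show ?thesis unfolding 4 2 using 1 by simp
  qed
  ultimately show ?thesis by (smt (verit) exp_le_cancel_iff)
qed

lemma arrows_probability_tendsto: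
  defines "N \<equiv> \<lambda>n. nat (round (5.219 * real n))"
  shows "(\<lambda>n. measure_pmf.prob (random_regular_graph (N n) 30) {G. arrows G (path_graph n)}) \<longlonglongrightarrow> 1"
proof -
  define k where "k n = (N n - 2 * n) div 4" for n
  have N: "\<bar>real (N n) - 5219 / 1000 * real n\<bar> \<le> 1 / 2" for n
  proof -
    have "real (N n) = of_int (round (5.219 * real n))"
      unfolding N_def by (rule of_nat_nat) (simp add: round_def)
    then show ?thesis using of_int_round_abs_le[of "5.219 * real n"] by simp
  qed
  \<comment> \<open>The floor costs at most \<open>3 / 4\<close> and the rounding less than
    \<open>1 / 10\<close>; any constant becomes negligible on division by
    \<open>N n\<close>.\<close>
  have k: "\<bar>real (k n) - 3219 / 20876 * real (N n)\<bar> \<le> 2" if "n \<ge> 1" for n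
  proof -
    have "2 * n \<le> N n" using N[of n] that by linarith
    then have "real (N n - 2 * n) = real (N n) - 2 * real n" by (simp add: of_nat_diff)
    moreover have "4 * k n \<le> N n - 2 * n" "N n - 2 * n \<le> 4 * k n + 3" unfolding k_def by presburger+
    then have "4 * real (k n) \<le> real (N n - 2 * n)" "real (N n - 2 * n) \<le> 4 * real (k n) + 3" by linarith+
    ultimately show ?thesis using N[of n] by linarith
  qed
  have N_top: "filterlim (\<lambda>n. real (N n)) at_top sequentially"
  proof (rule filterlim_at_top_mono[OF filterlim_real_sequentially])
    show "\<forall>\<^sub>F n in sequentially. real n \<le> real (N n)"
      using eventually_ge_at_top[of 1]
    proof eventually_elim
      case (elim n)
      then show ?case using N[of n] by linarith
    qed
  qed
  have N_large: "\<forall>\<^sub>F n in sequentially. real (N n) > C" for C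
    using N_top by (simp add: filterlim_at_top_dense)
  have "(\<lambda>n. real (k n) / real (N n) - 3219 / 20876) \<longlonglongrightarrow> 0"
  proof (rule Lim_null_comparison)
    show "(\<lambda>n. 2 / real (N n)) \<longlonglongrightarrow> 0"
      by (rule real_tendsto_divide_at_top[OF tendsto_const N_top])
    show "\<forall>\<^sub>F n in sequentially. norm (real (k n) / real (N n) - 3219 / 20876) \<le> 2 / real (N n)"
      using eventually_ge_at_top[of 1] N_large[of 0]
    proof eventually_elim
      case (elim n)
      have "real (k n) / real (N n) - 3219 / 20876 = (real (k n) - 3219 / 20876 * real (N n)) / real (N n)"
        using elim(2) by (simp add: field_simps)
      then have "norm (real (k n) / real (N n) - 3219 / 20876) = \<bar>real (k n) - 3219 / 20876 * real (N n)\<bar> / real (N n)"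
        by (simp only: real_norm_def abs_divide abs_of_nat)
      also have "\<dots> \<le> 2 / real (N n)" using k[OF elim(1)] by (rule divide_right_mono) simp
      finally show ?case .
    qed
  qed
  then have "(\<lambda>n. real (k n) / real (N n)) \<longlonglongrightarrow> 3219 / 20876" by (rule LIM_zero_cancel)
  then have rate: "(\<lambda>n. exponent_rate (real (k n) / real (N n))) \<longlonglongrightarrow> exponent_rate (3219 / 20876)"
    by (rule tendsto_exponent_rate)
  define C where "C = ln 2 + 3660 * ln 901 + 3 * ln 30 + (4::real)"
  have "((\<lambda>y. C / y + 7324 * (ln y / y)) \<longlongrightarrow> 0 + 7324 * 0) at_top"
    by (intro tendsto_intros ln_x_over_x_tendsto_0 real_tendsto_divide_at_top[OF tendsto_const] filterlim_ident)
  from filterlim_compose[OF this N_top]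
  have "(\<lambda>n. (C + 7324 * ln (real (N n))) / real (N n)) \<longlonglongrightarrow> 0" by (simp add: add_divide_distrib)
  from tendsto_add[OF this rate]
  have lim: "(\<lambda>n. (C + 7324 * ln (real (N n))) / real (N n) + exponent_rate (real (k n) / real (N n)))
      \<longlonglongrightarrow> exponent_rate (3219 / 20876)" by simp
  have neg: "exponent_rate (3219 / 20876) < 0"
    using exponent_negative unfolding exponent_rate_def .
  let ?B = "\<lambda>n. exp (((C + 7324 * ln (real (N n))) / real (N n) + exponent_rate (real (k n) / real (N n))) * real (N n))"
  have "?B \<longlonglongrightarrow> 0"
    by (rule filterlim_compose[OF exp_at_bot filterlim_tendsto_neg_mult_at_bot[OF lim neg N_top]])
  then have B: "(\<lambda>n. 1 - ?B n) \<longlonglongrightarrow> 1" using tendsto_diff[OF tendsto_const] by fastforce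
  have "\<forall>\<^sub>F n in sequentially. 1 - ?B n \<le> measure_pmf.prob (random_regular_graph (N n) 30) {G. arrows G (path_graph n)}"
    using eventually_ge_at_top[of 1] N_large[of 400]
  proof eventually_elim
    case (elim n)
    then have "k n \<ge> 1" using k[of n] by linarith
    then show ?case using arrows_probability_ge[OF _ k_def, of n] elim(2) by (simp add: C_def)
  qed
  then show ?thesis
    by (rule tendsto_sandwich[OF _ always_eventually B tendsto_const]) simp
qed

theorem theorem3p2:
  fixes c :: real and d :: nat
  assumes "c = 5.219" and "d = 30"
  shows "((\<lambda>n. measure_pmf.prob (random_regular_graph (nat (round (c * real n))) d)
            {G. arrows G (path_graph n)}) \<longlonglongrightarrow> 1)
       \<and> (\<forall>\<^sub>F n in sequentially. real (size_ramsey (path_graph n)) < 78.3 * real n)"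
proof
  let ?N = "\<lambda>n. nat (round (5.219 * real n))"
  have lim: "(\<lambda>n. measure_pmf.prob (random_regular_graph (?N n) 30) {G. arrows G (path_graph n)}) \<longlonglongrightarrow> 1"
    by (rule arrows_probability_tendsto)
  then show "(\<lambda>n. measure_pmf.prob (random_regular_graph (nat (round (c * real n))) d)
      {G. arrows G (path_graph n)}) \<longlonglongrightarrow> 1"
    by (simp only: assms)
  \<comment> \<open>Positive probability is enough to find one regular graph that arrows the
    path.\<close>
  have "\<forall>\<^sub>F n in sequentially. measure_pmf.prob (random_regular_graph (?N n) 30) {G. arrows G (path_graph n)} > 0"
    using order_tendstoD(1)[OF lim, of 0] by simp
  then show "\<forall>\<^sub>F n in sequentially. real (size_ramsey (path_graph n)) < 78.3 * real n"
    \<comment> \<open>The edge count is at most 78.285 n + 7.5, which is below 78.3 n once n > 500;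
      \<open>1000\<close> also ensures that regular graphs exist.\<close>
    using eventually_gt_at_top[of 1000]
  proof eventually_elim
    case (elim n)
    have N_int: "real (?N n) = of_int (round (5.219 * real n))"
      by (rule of_nat_nat) (simp add: round_def)
    then have N: "\<bar>real (?N n) - 5219 / 1000 * real n\<bar> \<le> 1 / 2"
      using of_int_round_abs_le[of "5.219 * real n"] by simp
    \<comment> \<open>The support of \<open>pmf_of_set\<close> is known only for a nonempty
      set.\<close>
    have "regular_graphs (?N n) 30 \<noteq> {}"
    proof (rule regular_graphs_nonempty[OF _ refl])
      show "2 * (15 * ?N n) = 30 * ?N n" by simp
      have "?N n > 1000" using N elim(2) by linarith
      then show "15 * ?N n > 2 * (30 + 2 * 30 * 30) + 30 * (2 * 30 + 2) + 5" by simp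
    qed
    then have set: "set_pmf (random_regular_graph (?N n) 30) = regular_graphs (?N n) 30"
      by (simp add: random_regular_graph_def finite_regular_graphs)
    have "set_pmf (random_regular_graph (?N n) 30) \<inter> {G. arrows G (path_graph n)} \<noteq> {}"
      using elim(1) measure_pmf_zero_iff by (metis less_irrefl)
    then obtain G where G: "G \<in> regular_graphs (?N n) 30" "arrows G (path_graph n)"
      unfolding set by blast
    have "simple_graph G" using G(1) by (simp add: regular_graphs_def)
    then have "card (edges G) \<in> {card (edges G) |G. simple_graph G \<and> arrows G (path_graph n)}"
      using G(2) by blast
    then have "size_ramsey (path_graph n) \<le> card (edges G)"
      unfolding size_ramsey_def by (rule cInf_lower) simp
    moreover have "card (edges G) = 15 * ?N n" using card_edges_regular_graph[OF G(1)] by simp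
    ultimately have "real (size_ramsey (path_graph n)) \<le> 15 * real (?N n)" by linarith
    then show ?case using N elim(2) by linarith
  qed
qed

end
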